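(* For each positive integer $t$, let $p_1,p_2,\dots,p_t$ be the first $t$ prime numbers congruent to $2$ modulo $3$, and let $G=G_t=A\rtimes P$ be a semidirect product (with $A$ normal in $G$), where $P\cong C_3$ and $A\cong C_{p_1}^2\times C_{p_2}^2\times\cdots\times C_{p_t}^2$, such that $C_A(P)=1$. Let $n=n_t=|G_t|$. Then $$\frac{S_c(G_t)}{S_c(C_{n_t})}\to\infty\quad\text{as}\quad t\to\infty.$$
   Context: All groups are finite. $C_k$ denotes the cyclic group of order $k$, $C_k^2=C_k\times C_k$, and $C_A(P)$ is the centralizer of $P$ in $A$. $\mathrm{Irr}(G)$ denotes the set of complex irreducible characters of a finite group $G$. For $\chi\in\mathrm{Irr}(G)$, the codegree of $\chi$ is $\mathrm{cod}(\chi)=\frac{|G:\ker\chi|}{\chi(1)}$. The sum of codegrees is $S_c(G)=\sum_{\chi\in\mathrm{Irr}(G)}\mathrm{cod}(\chi)$. *)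

theory Defs
  imports
    Complex_Main
    "HOL-Library.Infinite_Set"
    "HOL-Computational_Algebra.Primes"
    "HOL-Algebra.Elementary_Groups"
    "HOL-Algebra.Product_Groups"
    "Jordan_Normal_Form.VS_Connect"
begin

definition mat_trace :: "'a::comm_monoid_add mat \<Rightarrow> 'a" where
  "mat_trace M = (\<Sum>i<dim_row M. M $$ (i, i))"

abbreviation GL_complex :: "nat \<Rightarrow> complex mat monoid" where
  "GL_complex n \<equiv> units_of (ring_mat TYPE(complex) n ())"

definition irreducible_rep ::
  "('a, 'b) monoid_scheme \<Rightarrow> nat \<Rightarrow> ('a \<Rightarrow> complex mat) \<Rightarrow> bool" where
  "irreducible_rep G n \<rho> \<longleftrightarrow>
     n > 0 \<and> \<rho> \<in> hom G (GL_complex n) \<and>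
     (\<forall>W. subspace class_ring W (module_vec TYPE(complex) n) \<and>
          (\<forall>g\<in>carrier G. \<forall>w\<in>W. \<rho> g *\<^sub>v w \<in> W) \<longrightarrow>
          W = {0\<^sub>v n} \<or> W = carrier_vec n)"

(* Characters are restricted to the carrier (undefined outside it), so that two
   characters are equal as HOL functions iff they agree on the group. *)
definition rep_character ::
  "('a, 'b) monoid_scheme \<Rightarrow> ('a \<Rightarrow> complex mat) \<Rightarrow> 'a \<Rightarrow> complex" where
  "rep_character G \<rho> = (\<lambda>g\<in>carrier G. mat_trace (\<rho> g))"

definition Irr :: "('a, 'b) monoid_scheme \<Rightarrow> ('a \<Rightarrow> complex) set" where
  "Irr G = {rep_character G \<rho> |\<rho> n. irreducible_rep G n \<rho>}"

(* The textbook definition of the kernel of a character of a finite group; it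
   coincides with the kernel of any representation affording the character. *)
definition char_kernel :: "('a, 'b) monoid_scheme \<Rightarrow> ('a \<Rightarrow> complex) \<Rightarrow> 'a set" where
  "char_kernel G \<chi> = {g \<in> carrier G. \<chi> g = \<chi> \<one>\<^bsub>G\<^esub>}"

(* A character takes a positive integer value at the identity (its degree);
   Re only transfers that value to the reals. *)
definition codegree :: "('a, 'b) monoid_scheme \<Rightarrow> ('a \<Rightarrow> complex) \<Rightarrow> real" where
  "codegree G \<chi> =
     real (card (rcosets\<^bsub>G\<^esub> (char_kernel G \<chi>))) / Re (\<chi> \<one>\<^bsub>G\<^esub>)"

definition sum_codegrees :: "('a, 'b) monoid_scheme \<Rightarrow> real" where
  "sum_codegrees G = (\<Sum>\<chi>\<in>Irr G. codegree G \<chi>)"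

definition internal_semidirect_product ::
  "('a, 'b) monoid_scheme \<Rightarrow> 'a set \<Rightarrow> 'a set \<Rightarrow> bool" where
  "internal_semidirect_product G A P \<longleftrightarrow>
     A \<lhd> G \<and> subgroup P G \<and>
     A <#>\<^bsub>G\<^esub> P = carrier G \<and> A \<inter> P = {\<one>\<^bsub>G\<^esub>}"

definition centralizer_in ::
  "('a, 'b) monoid_scheme \<Rightarrow> 'a set \<Rightarrow> 'a set \<Rightarrow> 'a set" where
  "centralizer_in G A P = {a \<in> A. \<forall>x\<in>P. a \<otimes>\<^bsub>G\<^esub> x = x \<otimes>\<^bsub>G\<^esub> a}"

(* The primes congruent to 2 modulo 3 in increasing order, indexed from 0. *)
definition prime_2_mod_3 :: "nat \<Rightarrow> nat" where
  "prime_2_mod_3 = enumerate {p::nat. Factorial_Ring.prime p \<and> p mod 3 = 2}"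

end

theory Submission
  imports Defs "HOL-Number_Theory.Totient"
    "HOL-Algebra.Multiplicative_Group" "Jordan_Normal_Form.Schur_Decomposition"
begin

text \<open>The group is a Frobenius group with kernel \<open>A\<close> and complement
\<open>P\<close> of order \<open>3\<close>. A nontrivial linear character \<open>\<lambda>\<close>
of \<open>A\<close> induces an irreducible character of degree \<open>3\<close>, whose kernel is
the largest normal subgroup of \<open>G\<close> inside the kernel of \<open>\<lambda>\<close>,
called the core of \<open>\<lambda>\<close> below, and whose codegree is consequently the index of
this core in \<open>A\<close>. At most three characters \<open>\<lambda>\<close> induce the same
character, so the sum of codegrees of \<open>G\<close> is at least a third of the sum of these
indices (\<open>sum_codegrees_ge\<close>).

The indices are large. For a prime \<open>p\<close> congruent to \<open>2\<close> modulo
\<open>3\<close>, the order of \<open>P\<close> does not divide \<open>p - 1\<close>, so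
\<open>P\<close> leaves no subgroup of order \<open>p\<close> in \<open>C\<^sub>p \<times>
C\<^sub>p\<close> invariant; as soon as \<open>\<lambda>\<close> is nontrivial on this factor, the
core meets it trivially (\<open>core_axis_trivial\<close>) and the index acquires a factor
\<open>p\<^sup>2\<close>, although \<open>\<lambda>\<close> itself only has order \<open>p\<close>
there. Summing over all \<open>\<lambda>\<close> yields a lower bound by the product of \<open>p^4
- p^2 + 1\<close>, up to a constant (\<open>sum_codegrees_rank_two_ge\<close>). In the cyclic
group of the same order the codegrees are the orders of the elements, and the sum is at most
\<open>7\<close> times the product of \<open>p^4 - p^3 + p^2 - p + 1\<close>
(\<open>sum_codegrees_cyclic_le\<close>, \<open>divisor_totient_sum_le\<close>).

The quotient is therefore at least a constant times a product of factors of size about \<open>1 +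
1/p\<close>, and it remains to see that the sum of \<open>1/p\<close> over the primes
\<open>p\<close> congruent to \<open>2\<close> modulo \<open>3\<close> diverges. Start with the
partial sums of \<open>\<chi>(n)/n\<close> for the nontrivial character \<open>\<chi>\<close>
modulo \<open>3\<close>, which are bounded by \<open>1\<close>. Changing the value of a completely
multiplicative function at a single prime \<open>p\<close> to \<open>1\<close> increases a bound
for its partial sums at most by the factor \<open>(p + 1)/(p - 1)\<close>. After the change at
\<open>3\<close> and at all primes up to \<open>x\<close> that are congruent to \<open>2\<close>,
the partial sum at \<open>x\<close> is a harmonic sum, so the product of these factors is
unbounded (\<open>prod_primes_2_mod_3_ge\<close>).\<close>

section \<open>Divergence along the primes congruent to 2 modulo 3\<close>

definition completely_mult :: "(nat \<Rightarrow> real) \<Rightarrow> bool" where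
  "completely_mult f \<longleftrightarrow> f 1 = 1 \<and> (\<forall>a>0. \<forall>b>0. f (a * b) = f a * f b)"

definition weighted_sum :: "(nat \<Rightarrow> real) \<Rightarrow> nat \<Rightarrow> real" where
  "weighted_sum f y = (\<Sum>n\<in>{1..y}. f n / real n)"

text \<open>For a completely multiplicative \<open>f\<close> this is the completely multiplicative
function that takes the value \<open>1\<close> at \<open>p\<close> and agrees with
\<open>f\<close> at all other primes.\<close>
definition forget_prime :: "nat \<Rightarrow> (nat \<Rightarrow> real) \<Rightarrow> nat \<Rightarrow> real" where
  "forget_prime p f n = f (n div p ^ multiplicity p n)"

lemma completely_mult_forget_prime:
  assumes "completely_mult f" "prime p"
  shows "completely_mult (forget_prime p f)"
proof -
  have "f ((a * b) div p ^ multiplicity p (a * b)) =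
      f (a div p ^ multiplicity p a) * f (b div p ^ multiplicity p b)" if "a > 0" "b > 0" for a b
  proof -
    have m: "multiplicity p (a * b) = multiplicity p a + multiplicity p b"
      using assms(2) that by (simp add: prime_elem_multiplicity_mult_distrib)
    have "(a * b) div p ^ multiplicity p (a * b)
        = (a div p ^ multiplicity p a) * (b div p ^ multiplicity p b)"
      unfolding m power_add by (simp add: div_mult_div_if_dvd multiplicity_dvd)
    moreover have "a div p ^ multiplicity p a > 0" "b div p ^ multiplicity p b > 0"
      using that by (auto simp: div_greater_zero_iff intro!: dvd_imp_le multiplicity_dvd prime_gt_0_nat[OF assms(2)])
    ultimately show ?thesis
      using assms(1) unfolding completely_mult_def by metis
  qed
  moreover have "forget_prime p f 1 = 1"
    using assms(1) by (simp add: forget_prime_def completely_mult_def)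
  ultimately show ?thesis
    by (simp add: completely_mult_def forget_prime_def)
qed

lemma forget_prime_coprime: "\<not> p dvd n \<Longrightarrow> forget_prime p f n = f n"
  by (simp add: forget_prime_def not_dvd_imp_multiplicity_0)

lemma forget_prime_prime:
  assumes "completely_mult f" "prime p" "prime q"
  shows "forget_prime p f q = (if q = p then 1 else f q)"
proof (cases "q = p")
  case True
  then show ?thesis
    using assms by (simp add: forget_prime_def completely_mult_def)
next
  case False
  then have "\<not> p dvd q" using assms(2,3) primes_dvd_imp_eq by blast
  then show ?thesis using False by (simp add: forget_prime_coprime)
qed

text \<open>The terms \<open>n = p * k\<close> form a scaled copy of the same sum, truncated at
\<open>y div p\<close>. This is the finite form of isolating the Euler factor at \<open>p\<close>
in the Dirichlet series of \<open>f\<close> at \<open>1\<close>.\<close>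
lemma weighted_sum_split:
  assumes "completely_mult f" "prime p"
  shows "weighted_sum f y =
    (\<Sum>n\<in>{n\<in>{1..y}. \<not> p dvd n}. f n / real n) + f p / real p * weighted_sum f (y div p)"
proof -
  have p0: "p > 0" using assms(2) by (simp add: prime_gt_0_nat)
  have split: "{1..y} = {n\<in>{1..y}. \<not> p dvd n} \<union> (\<lambda>k. p * k) ` {1..y div p}"
  proof (intro equalityI subsetI)
    fix n assume n: "n \<in> {1..y}"
    show "n \<in> {n\<in>{1..y}. \<not> p dvd n} \<union> (\<lambda>k. p * k) ` {1..y div p}"
    proof (cases "p dvd n")
      case True
      then obtain k where k: "n = p * k" by blast
      have "k \<ge> 1" "k \<le> y div p" using n k p0
        by (auto simp: less_eq_div_iff_mult_less_eq mult.commute Suc_le_eq)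
      then show ?thesis using k by auto
    qed (use n in auto)
  next
    fix n assume "n \<in> {n\<in>{1..y}. \<not> p dvd n} \<union> (\<lambda>k. p * k) ` {1..y div p}"
    then show "n \<in> {1..y}" using p0
      by (auto simp: less_eq_div_iff_mult_less_eq mult.commute Suc_le_eq)
  qed
  have "weighted_sum f y = (\<Sum>n\<in>{n\<in>{1..y}. \<not> p dvd n}. f n / real n)
       + (\<Sum>n\<in>(\<lambda>k. p * k) ` {1..y div p}. f n / real n)"
    unfolding weighted_sum_def by (subst split, rule sum.union_disjoint) auto
  also have "(\<Sum>n\<in>(\<lambda>k. p * k) ` {1..y div p}. f n / real n)
      = (\<Sum>k\<in>{1..y div p}. f (p * k) / real (p * k))"
    by (subst sum.reindex) (use p0 in \<open>auto simp: inj_on_def\<close>)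
  also have "\<dots> = f p / real p * weighted_sum f (y div p)"
    unfolding weighted_sum_def sum_distrib_left
    by (rule sum.cong) (use assms(1) p0 in \<open>auto simp: completely_mult_def\<close>)
  finally show ?thesis .
qed

text \<open>Since \<open>f\<close> and the new function \<open>g\<close> agree off the multiples
of \<open>p\<close>, splitting both sums at \<open>p\<close> gives \<open>H g y = H f y - (f p /
p) * H f (y div p) + (1 / p) * H g (y div p)\<close>, where \<open>H\<close> is the weighted sum.
The first two terms are at most \<open>M * (1 + 1/p)\<close>, and the last one is treated by
induction on \<open>y\<close>; the geometric series that arises contributes \<open>1 / (1 -
1/p)\<close>.\<close>
lemma weighted_sum_forget_prime_bound:
  assumes f: "completely_mult f" and p: "prime p" and fp: "\<bar>f p\<bar> \<le> 1"
    and M: "\<And>y. \<bar>weighted_sum f y\<bar> \<le> M"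
  shows "\<bar>weighted_sum (forget_prime p f) y\<bar> \<le> M * ((real p + 1) / (real p - 1))"
proof (induction y rule: less_induct)
  case (less y)
  let ?g = "forget_prime p f"
  let ?C = "M * ((real p + 1) / (real p - 1))"
  have p2: "real p \<ge> 2" using p prime_ge_2_nat by force
  have M0: "M \<ge> 0" using M[of 0] by (auto simp: weighted_sum_def)
  show ?case
  proof (cases "y = 0")
    case True
    then show ?thesis using M0 p2 by (auto simp: weighted_sum_def)
  next
    case False
    then have lt: "y div p < y" using p2 by (intro div_less_dividend) auto
    have g: "completely_mult ?g" "?g p = 1"
      using completely_mult_forget_prime[OF f p] forget_prime_prime[OF f p p] by auto
    have eq: "(\<Sum>n\<in>{n\<in>{1..y}. \<not> p dvd n}. ?g n / real n) = (\<Sum>n\<in>{n\<in>{1..y}. \<not> p dvd n}. f n / real n)"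
      by (rule sum.cong) (auto simp: forget_prime_coprime)
    have "weighted_sum ?g y = weighted_sum f y - f p / real p * weighted_sum f (y div p)
         + 1 / real p * weighted_sum ?g (y div p)"
      using weighted_sum_split[OF f p, of y] weighted_sum_split[OF g(1) p, of y] eq g(2) by simp
    moreover have "\<bar>f p / real p * weighted_sum f (y div p)\<bar> \<le> 1 / real p * M"
      unfolding abs_mult using M[of "y div p"] fp p2
      by (intro mult_mono) (auto simp: divide_right_mono)
    moreover have "\<bar>1 / real p * weighted_sum ?g (y div p)\<bar> \<le> 1 / real p * ?C"
      unfolding abs_mult using less.IH[OF lt] p2 by (intro mult_mono) auto
    ultimately have "\<bar>weighted_sum ?g y\<bar> \<le> M + 1 / real p * M + 1 / real p * ?C"
      using M[of y] by linarith
    also have "\<dots> = ?C" using p2 by (simp add: field_simps)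
    finally show ?thesis .
  qed
qed

lemma forget_primes:
  assumes "finite S" "\<And>p. p \<in> S \<Longrightarrow> prime p"
    and f: "completely_mult f" "\<And>q. prime q \<Longrightarrow> \<bar>f q\<bar> \<le> 1" "\<And>y. \<bar>weighted_sum f y\<bar> \<le> M"
  shows "\<exists>g. completely_mult g \<and> (\<forall>q. prime q \<longrightarrow> g q = (if q \<in> S then 1 else f q)) \<and>
     (\<forall>y. \<bar>weighted_sum g y\<bar> \<le> M * (\<Prod>p\<in>S. (real p + 1) / (real p - 1)))"
  using assms(1,2)
proof (induction S rule: finite_induct)
  case empty
  then show ?case using f by (intro exI[of _ f]) auto
next
  case (insert p S)
  then obtain g where g: "completely_mult g" "\<And>q. prime q \<Longrightarrow> g q = (if q \<in> S then 1 else f q)"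
    "\<And>y. \<bar>weighted_sum g y\<bar> \<le> M * (\<Prod>p\<in>S. (real p + 1) / (real p - 1))" by auto
  have p: "prime p" using insert by auto
  have gp: "\<bar>g p\<bar> \<le> 1" using g(2)[OF p] f(2)[OF p] by auto
  have "\<bar>weighted_sum (forget_prime p g) y\<bar> \<le> M * (\<Prod>p\<in>insert p S. (real p + 1) / (real p - 1))" for y
    using weighted_sum_forget_prime_bound[OF g(1) p gp g(3), of y] insert(1,2)
    by (simp add: algebra_simps)
  moreover have "forget_prime p g q = (if q \<in> insert p S then 1 else f q)" if "prime q" for q
    using forget_prime_prime[OF g(1) p that] g(2)[OF that] by auto
  ultimately show ?case
    using completely_mult_forget_prime[OF g(1) p] by blast
qed

text \<open>The nontrivial Dirichlet character modulo \<open>3\<close>.\<close>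
definition chi3 :: "nat \<Rightarrow> real" where
  "chi3 n = (if n mod 3 = 1 then 1 else if n mod 3 = 2 then -1 else 0)"

lemma completely_mult_chi3: "completely_mult chi3"
proof -
  have "chi3 (a * b) = chi3 a * chi3 b" for a b
  proof -
    have "a mod 3 < 3" "b mod 3 < 3" by auto
    then have "a mod 3 \<in> {0,1,2}" "b mod 3 \<in> {0,1,2}" by auto
    then show ?thesis
      unfolding chi3_def mod_mult_eq[of a 3 b, symmetric] by auto
  qed
  then show ?thesis by (auto simp: completely_mult_def chi3_def)
qed

text \<open>The series \<open>1 - 1/2 + 1/4 - 1/5 + \<dots>\<close> alternates with decreasing
terms. The induction over full periods carries the sharper upper bound \<open>1 -
1/(3k+1)\<close>, which leaves room for the next positive term.\<close>
lemma weighted_sum_chi3_bound: "\<bar>weighted_sum chi3 y\<bar> \<le> 1"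
proof -
  have ws_Suc: "weighted_sum chi3 (Suc y) = weighted_sum chi3 y + chi3 (Suc y) / real (Suc y)" for y
    by (simp add: weighted_sum_def)
  have step: "chi3 (Suc (3 * k)) = 1" "chi3 (Suc (Suc (3 * k))) = -1" "chi3 (Suc (Suc (Suc (3 * k)))) = 0"
    for k
  proof -
    have "Suc (3 * k) mod 3 = 1" "Suc (Suc (3 * k)) mod 3 = 2" "Suc (Suc (Suc (3 * k))) mod 3 = 0"
      by presburger+
    then show "chi3 (Suc (3 * k)) = 1" "chi3 (Suc (Suc (3 * k))) = -1" "chi3 (Suc (Suc (Suc (3 * k)))) = 0"
      by (simp_all add: chi3_def)
  qed
  have main: "0 \<le> weighted_sum chi3 (3 * k) \<and> weighted_sum chi3 (3 * k) \<le> 1 - 1 / (3 * real k + 1)" for k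
  proof (induction k)
    case 0
    then show ?case by (simp add: weighted_sum_def)
  next
    case (Suc k)
    have e: "3 * Suc k = Suc (Suc (Suc (3 * k)))" by simp
    have "weighted_sum chi3 (3 * Suc k) =
        weighted_sum chi3 (3 * k) + 1 / (3 * real k + 1) - 1 / (3 * real k + 2)"
      unfolding e ws_Suc step by (simp add: add_ac)
    moreover have "1 / (3 * real k + 2) \<le> 1 / (3 * real k + 1)"
      by (simp add: frac_le)
    moreover have "1 / (3 * real (Suc k) + 1) \<le> 1 / (3 * real k + 2)"
      by (simp add: frac_le)
    ultimately show ?case using Suc.IH by linarith
  qed
  define k where "k = y div 3"
  have "y mod 3 < 3" by simp
  then have "y mod 3 = 0 \<or> y mod 3 = 1 \<or> y mod 3 = 2" by linarith
  then have y: "y = 3 * k \<or> y = Suc (3 * k) \<or> y = Suc (Suc (3 * k))"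
    unfolding k_def using mult_div_mod_eq[of 3 y] by linarith
  have "1 / (3 * real k + 2) \<le> 1 / (3 * real k + 1)" by (simp add: frac_le)
  moreover have "1 / (3 * real k + 1) \<ge> 0" "1 / (3 * real k + 2) \<ge> 0" by simp_all
  moreover have "weighted_sum chi3 (Suc (3 * k)) = weighted_sum chi3 (3 * k) + 1 / (3 * real k + 1)"
    unfolding ws_Suc step by (simp add: add_ac)
  moreover have "weighted_sum chi3 (Suc (Suc (3 * k))) =
      weighted_sum chi3 (3 * k) + 1 / (3 * real k + 1) - 1 / (3 * real k + 2)"
    unfolding ws_Suc step by (simp add: add_ac)
  moreover have "0 \<le> weighted_sum chi3 (3 * k)" "weighted_sum chi3 (3 * k) \<le> 1 - 1 / (3 * real k + 1)"
    using main[of k] by auto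
  ultimately have "\<bar>weighted_sum chi3 (3 * k)\<bar> \<le> 1 \<and> \<bar>weighted_sum chi3 (Suc (3 * k))\<bar> \<le> 1 \<and>
    \<bar>weighted_sum chi3 (Suc (Suc (3 * k)))\<bar> \<le> 1" by linarith
  with y show ?thesis by (elim disjE) simp_all
qed

lemma completely_mult_eq_1:
  assumes "completely_mult g" "\<And>q. prime q \<Longrightarrow> q dvd n \<Longrightarrow> g q = 1" "n > 0"
  shows "g n = 1"
  using assms(2,3)
proof (induction n rule: less_induct)
  case (less n)
  show ?case
  proof (cases "n = 1")
    case True
    then show ?thesis using assms(1) by (simp add: completely_mult_def)
  next
    case False
    then obtain q where q: "prime q" "q dvd n" using prime_factor_nat by blast
    then obtain k where k: "n = q * k" by blast
    have k0: "k > 0" using k less.prems by auto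
    have "k < n" using k k0 prime_gt_1_nat[OF q(1)] by simp
    moreover have "\<And>r. prime r \<Longrightarrow> r dvd k \<Longrightarrow> g r = 1" using less.prems(1) k by auto
    ultimately have "g k = 1" using less.IH k0 by blast
    moreover have "g n = g q * g k"
      using assms(1) k k0 prime_gt_0_nat[OF q(1)] by (simp add: completely_mult_def)
    ultimately show ?thesis using less.prems(1) q by simp
  qed
qed

text \<open>The character modulo \<open>3\<close> is already \<open>1\<close> at the primes
congruent to \<open>1\<close>. Forcing the value \<open>1\<close> at the prime \<open>3\<close>
and at the primes in \<open>S\<close> therefore produces a function that is constantly
\<open>1\<close> up to \<open>x\<close>, whose weighted sum is a harmonic sum, while the bound
grows only by the stated product. The factor \<open>2\<close> is the contribution \<open>(3 + 1) /
(3 - 1)\<close> of the prime \<open>3\<close>. In analytic terms: the zeta function has a pole at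
\<open>1\<close>, the \<open>L\<close>-function of the character stays bounded there, and their
quotient is a product over the primes that are not \<open>1\<close> modulo \<open>3\<close>, which
must therefore diverge.\<close>
lemma prod_primes_2_mod_3_ge:
  assumes S: "finite S" "\<And>p. p \<in> S \<Longrightarrow> prime p \<and> p mod 3 = 2"
    and all: "\<And>p. prime p \<Longrightarrow> p mod 3 = 2 \<Longrightarrow> p \<le> x \<Longrightarrow> p \<in> S"
  shows "(\<Sum>n\<in>{1..x}. 1 / real n) \<le> 2 * (\<Prod>p\<in>S. (real p + 1) / (real p - 1))"
proof -
  have three: "prime (3::nat)" by simp
  have chi3_le: "\<bar>chi3 q\<bar> \<le> 1" for q by (simp add: chi3_def)
  have S3: "3 \<notin> S" using S(2)[of 3] by auto
  obtain g where g: "completely_mult g"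
    "\<And>q. prime q \<Longrightarrow> g q = (if q \<in> insert 3 S then 1 else chi3 q)"
    "\<And>y. \<bar>weighted_sum g y\<bar> \<le> 1 * (\<Prod>p\<in>insert 3 S. (real p + 1) / (real p - 1))"
    using forget_primes[of "insert 3 S" chi3 1, OF _ _ completely_mult_chi3 _ weighted_sum_chi3_bound]
      S three chi3_le by blast
  have "g n = 1" if "n \<in> {1..x}" for n
  proof (rule completely_mult_eq_1[OF g(1)])
    fix q :: nat assume q: "prime q" "q dvd n"
    have "q \<le> x" using q(2) that dvd_imp_le[of q n] by auto
    have "q mod 3 < 3" by simp
    then consider "q mod 3 = 0" | "q mod 3 = 1" | "q mod 3 = 2" by linarith
    then show "g q = 1"
    proof cases
      case 1
      then have "3 dvd q" by presburger
      then have "q = 3" using q(1) three primes_dvd_imp_eq by blast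
      then show ?thesis using g(2)[OF q(1)] by simp
    next
      case 2
      then show ?thesis using g(2)[OF q(1)] by (simp add: chi3_def)
    next
      case 3
      then show ?thesis using g(2)[OF q(1)] all q(1) \<open>q \<le> x\<close> by simp
    qed
  qed (use that in auto)
  then have "weighted_sum g x = (\<Sum>n\<in>{1..x}. 1 / real n)"
    by (simp add: weighted_sum_def)
  then show ?thesis using g(3)[of x] S3 S(1) by simp
qed

text \<open>Each block of terms with \<open>2 ^ k < n \<le> 2 ^ (k + 1)\<close> contributes at
least \<open>1/2\<close>.\<close>
lemma harmonic_at_top: "filterlim (\<lambda>x. \<Sum>n\<in>{1..x}. 1 / real n) at_top sequentially"
proof -
  let ?H = "\<lambda>x. \<Sum>n\<in>{1..x}. 1 / real n"
  have lower: "real k / 2 \<le> ?H (2 ^ k)" for k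
  proof (induction k)
    case (Suc k)
    have split: "{1..2 ^ Suc k} = {1..2 ^ k} \<union> {2 ^ k<..2 ^ Suc k :: nat}"
      by (auto simp: Suc_le_eq)
    have "?H (2 ^ Suc k) = ?H (2 ^ k) + (\<Sum>n\<in>{2 ^ k<..2 ^ Suc k}. 1 / real n)"
      unfolding split by (rule sum.union_disjoint) auto
    moreover have "real (card {2 ^ k<..2 ^ Suc k :: nat}) * (1 / 2 ^ Suc k)
        \<le> (\<Sum>n\<in>{2 ^ k<..2 ^ Suc k}. 1 / real n)"
    proof (rule sum_bounded_below)
      fix n :: nat assume n: "n \<in> {2 ^ k<..2 ^ Suc k}"
      then have "real n \<le> real (2 ^ Suc k)" by (simp only: of_nat_le_iff greaterThanAtMost_iff)
      then show "1 / 2 ^ Suc k \<le> 1 / real n" using n by (intro frac_le) auto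
    qed
    moreover have "real (card {2 ^ k<..2 ^ Suc k :: nat}) * (1 / 2 ^ Suc k) = 1 / 2" by simp
    ultimately show ?case using Suc.IH by simp
  qed simp
  show ?thesis
    unfolding filterlim_at_top eventually_sequentially
  proof
    fix Z :: real
    obtain k :: nat where k: "2 * Z \<le> real k" using real_arch_simple by blast
    have "Z \<le> ?H x" if "2 ^ k \<le> x" for x
    proof -
      have "?H (2 ^ k) \<le> ?H x" using that by (intro sum_mono2) auto
      then show ?thesis using lower[of k] k by linarith
    qed
    then show "\<exists>N. \<forall>x\<ge>N. Z \<le> ?H x" by blast
  qed
qed

lemma infinite_primes_2_mod_3: "infinite {p::nat. prime p \<and> p mod 3 = 2}"
proof
  assume fin: "finite {p::nat. prime p \<and> p mod 3 = 2}"
  let ?S = "{p::nat. prime p \<and> p mod 3 = 2}"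
  let ?B = "2 * (\<Prod>p\<in>?S. (real p + 1) / (real p - 1))"
  have "(\<Sum>n\<in>{1..x}. 1 / real n) \<le> ?B" for x
    by (rule prod_primes_2_mod_3_ge[OF fin]) auto
  moreover have "eventually (\<lambda>x. (\<Sum>n\<in>{1..x}. 1 / real n) \<ge> ?B + 1) sequentially"
    using harmonic_at_top unfolding filterlim_at_top by blast
  ultimately show False
    by (smt (verit, best) eventually_sequentially le_refl)
qed

lemma prime_2_mod_3_props:
  shows "prime (prime_2_mod_3 i)" "prime_2_mod_3 i mod 3 = 2" "inj prime_2_mod_3"
    and "prime p \<Longrightarrow> p mod 3 = 2 \<Longrightarrow> p \<le> t \<Longrightarrow> p \<in> prime_2_mod_3 ` {..<Suc t}"
proof -
  let ?S = "{p::nat. prime p \<and> p mod 3 = 2}"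
  note inf = infinite_primes_2_mod_3
  show "prime (prime_2_mod_3 i)" "prime_2_mod_3 i mod 3 = 2"
    using enumerate_in_set[OF inf, of i] unfolding prime_2_mod_3_def by auto
  show "inj prime_2_mod_3"
    unfolding prime_2_mod_3_def using strict_mono_enumerate[OF inf] by (rule strict_mono_imp_inj_on)
  assume p: "prime p" "p mod 3 = 2" "p \<le> t"
  then obtain i where i: "enumerate ?S i = p"
    using enumerate_Ex[OF inf, of p] by auto
  have "i \<le> t" using le_enumerate[OF inf, of i] i p(3) by linarith
  then show "p \<in> prime_2_mod_3 ` {..<Suc t}"
    using i unfolding prime_2_mod_3_def by auto
qed

lemma prod_ratio_at_top:
  "filterlim (\<lambda>t. \<Prod>i<t. (real (prime_2_mod_3 i) + 1) / (real (prime_2_mod_3 i) - 1)) at_top sequentially"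
proof -
  let ?F = "\<lambda>t. \<Prod>i<t. (real (prime_2_mod_3 i) + 1) / (real (prime_2_mod_3 i) - 1)"
  have "(\<Sum>n\<in>{1..t}. 1 / real n) / 2 \<le> ?F (Suc t)" for t
  proof -
    let ?S = "prime_2_mod_3 ` {..<Suc t}"
    have "(\<Sum>n\<in>{1..t}. 1 / real n) \<le> 2 * (\<Prod>p\<in>?S. (real p + 1) / (real p - 1))"
      by (rule prod_primes_2_mod_3_ge) (use prime_2_mod_3_props in auto)
    also have "(\<Prod>p\<in>?S. (real p + 1) / (real p - 1)) = ?F (Suc t)"
      by (subst prod.reindex) (auto intro: inj_on_subset[OF prime_2_mod_3_props(3)])
    finally have *: "(\<Sum>n\<in>{1..t}. 1 / real n) \<le> 2 * ?F (Suc t)" .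
    have "a / 2 \<le> b" if "a \<le> 2 * b" for a b :: real using that by simp
    from this[OF *] show ?thesis .
  qed
  moreover have "filterlim (\<lambda>t. (\<Sum>n\<in>{1..t}. 1 / real n) / 2) at_top sequentially"
    using filterlim_tendsto_pos_mult_at_top[OF tendsto_const[of "1/2::real"] _ harmonic_at_top]
    by simp
  ultimately have "filterlim (\<lambda>t. ?F (Suc t)) at_top sequentially"
    by (intro filterlim_at_top_mono[OF \<open>filterlim (\<lambda>t. (\<Sum>n\<in>{1..t}. 1 / real n) / 2) at_top sequentially\<close>]
        always_eventually allI)
  then show ?thesis by (rule filterlim_sequentially_Suc[THEN iffD1])
qed

text \<open>The right-hand base is \<open>1 + p(p-1)^2/D\<close> with denominator
\<open>D\<close>, roughly \<open>1 + 1/p\<close>, and \<open>(p+1)/(p-1)\<close> is \<open>1 +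
2/(p-1)\<close>. By Bernoulli's inequality an exponent \<open>k\<close> suffices once \<open>2 D
\<le> k p (p-1)^3\<close>; the worst case is \<open>p = 2\<close>, where \<open>k = 11\<close>
gives equality.\<close>
lemma ratio_power_ge:
  fixes p :: real
  assumes "p \<ge> 2"
  shows "(p + 1) / (p - 1) \<le> ((p^4 - p^2 + 1) / (p^4 - p^3 + p^2 - p + 1)) ^ 11"
proof -
  \<comment> \<open>In terms of \<open>q = p - 2\<close> all the coefficients below are
  nonnegative.\<close>
  define q where "q = p - 2"
  have q: "q \<ge> 0" "p = q + 2" using assms by (auto simp: q_def)
  define D where "D = p^4 - p^3 + p^2 - p + 1"
  have D: "D = q^4 + 7*q^3 + 19*q^2 + 23*q + 11"
    unfolding D_def q(2) by (simp add: algebra_simps power_numeral_reduce)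
  have D0: "D > 0" unfolding D using q by (auto intro!: add_nonneg_pos)
  have "11 * (p * (p-1)^3) - 2 * D = 9*q^4 + 41*q^3 + 61*q^2 + 31*q"
    unfolding D unfolding q(2) by (simp add: algebra_simps power_numeral_reduce)
  also have "\<dots> \<ge> 0" using q by auto
  finally have k: "2 * D \<le> 11 * (p * (p-1)^3)" by simp
  have "(p + 1) / (p - 1) = 1 + 2 / (p - 1)" using assms by (simp add: field_simps)
  also have "2 / (p - 1) \<le> 11 * (p * (p-1)^2 / D)"
    using k D0 assms by (simp add: field_simps power_numeral_reduce)
  also have "1 + 11 * (p * (p-1)^2 / D) \<le> (1 + p * (p-1)^2 / D) ^ 11"
    proof -
    have "p * (p-1)^2 / D \<ge> 0" using D0 assms by simp
    then show ?thesis using Bernoulli_inequality[of "p * (p-1)^2 / D" 11] by simp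
  qed
  also have "1 + p * (p-1)^2 / D = (p^4 - p^2 + 1) / D"
    using D0 by (simp add: field_simps) (simp add: D_def algebra_simps power_numeral_reduce)
  finally show ?thesis by (simp add: D_def)
qed

lemma prod_codegree_ratio_at_top:
  "filterlim (\<lambda>t. \<Prod>i<t. (real (prime_2_mod_3 i)^4 - real (prime_2_mod_3 i)^2 + 1) /
      (real (prime_2_mod_3 i)^4 - real (prime_2_mod_3 i)^3 + real (prime_2_mod_3 i)^2 - real (prime_2_mod_3 i) + 1))
    at_top sequentially" (is "filterlim ?R at_top sequentially")
proof -
  let ?F = "\<lambda>t. \<Prod>i<t. (real (prime_2_mod_3 i) + 1) / (real (prime_2_mod_3 i) - 1)"
  have p2: "real (prime_2_mod_3 i) \<ge> 2" for i
    using prime_ge_2_nat[OF prime_2_mod_3_props(1)[of i]] by simp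
  have le: "?F t \<le> ?R t ^ 11" for t
    unfolding prod_power_distrib
  proof (rule prod_mono, intro conjI)
    fix i
    show "0 \<le> (real (prime_2_mod_3 i) + 1) / (real (prime_2_mod_3 i) - 1)"
      using p2[of i] by auto
  qed (rule ratio_power_ge[OF p2])
  have Rnn: "?R t \<ge> 0" for t
  proof (rule prod_nonneg, safe)
    fix i
    let ?p = "real (prime_2_mod_3 i)"
    have "0 < ((?p + 1) / (?p - 1))" using p2[of i] by auto
    also note ratio_power_ge[OF p2[of i]]
    finally show "0 \<le> (?p^4 - ?p^2 + 1) / (?p^4 - ?p^3 + ?p^2 - ?p + 1)"
      by (simp add: zero_less_power_eq)
  qed
  show ?thesis
    unfolding filterlim_at_top
  proof
    fix Z :: real
    have "eventually (\<lambda>t. ?F t \<ge> (max Z 0) ^ 11) sequentially"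
      using prod_ratio_at_top unfolding filterlim_at_top by blast
    then show "eventually (\<lambda>t. ?R t \<ge> Z) sequentially"
    proof eventually_elim
      case (elim t)
      then have "(max Z 0) ^ 11 \<le> ?R t ^ 11" using le[of t] by linarith
      then have "max Z 0 \<le> ?R t" by (rule power_mono_iff[THEN iffD1, rotated -1]) (use Rnn in auto)
      then show ?case by simp
    qed
  qed
qed

section \<open>Complex representations of finite groups\<close>

lemma trace_mult_commute:
  assumes "A \<in> carrier_mat n m" "B \<in> carrier_mat m n"
  shows "mat_trace (A * B :: complex mat) = mat_trace (B * A)"
proof -
  have "mat_trace (A * B) = (\<Sum>i<n. \<Sum>j<m. A $$ (i,j) * B $$ (j,i))"
    unfolding mat_trace_def using assms
    by (intro sum.cong) (auto simp: scalar_prod_def atLeast0LessThan)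
  also have "\<dots> = (\<Sum>j<m. \<Sum>i<n. B $$ (j,i) * A $$ (i,j))"
    by (subst sum.swap) (simp add: mult.commute)
  also have "\<dots> = mat_trace (B * A)"
    unfolding mat_trace_def using assms
    by (intro sum.cong) (auto simp: scalar_prod_def atLeast0LessThan)
  finally show ?thesis .
qed

text \<open>The eigenvalues are listed with multiplicity, as the diagonal of a Schur triangular
form.\<close>
lemma trace_eq_sum_eigenvalues:
  fixes A :: "complex mat"
  assumes A: "A \<in> carrier_mat n n"
  obtains es where "length es = n" "\<And>e. e \<in> set es \<Longrightarrow> eigenvalue A e" "mat_trace A = sum_list es"
proof -
  obtain es where es: "char_poly A = (\<Prod>a\<leftarrow>es. [:- a, 1:])" "length es = n"
    using char_poly_factorized[OF A] by blast
  obtain B P Q where d: "schur_decomposition A es = (B,P,Q)"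
    by (cases "schur_decomposition A es") auto
  from schur_decomposition[OF A es(1) d] have sim: "similar_mat_wit A B P Q" and diag: "diag_mat B = es"
    by auto
  note w = similar_mat_witD2[OF A sim]
  have "mat_trace A = mat_trace (P * (B * Q))" using w by (simp add: assoc_mult_mat[of _ n n _ n _ n])
  also have "\<dots> = mat_trace (B * Q * P)" by (rule trace_mult_commute[of _ n n]) (use w in auto)
  also have "B * Q * P = B" using w by (simp add: assoc_mult_mat[of _ n n _ n _ n])
  also have "mat_trace B = sum_list es"
    unfolding diag[symmetric] mat_trace_def diag_mat_def using w
    by (simp add: interv_sum_list_conv_sum_set_nat atLeast0LessThan)
  finally have "mat_trace A = sum_list es" .
  moreover have "eigenvalue A e" if "e \<in> set es" for e
    unfolding eigenvalue_root_char_poly[OF A] es(1) poly_prod_list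
    using that by (auto simp: prod_list_zero_iff)
  ultimately show ?thesis using that es(2) by blast
qed


lemma GL_complex_simps:
  "carrier (GL_complex n) = Units (ring_mat TYPE(complex) n ())"
  "monoid.mult (GL_complex n) = (*)"
  "monoid.one (GL_complex n) = 1\<^sub>m n"
  by (auto simp: units_of_def ring_mat_simps)

lemma group_GL_complex: "group (GL_complex n)"
  by (rule monoid.units_group) (rule ring.is_monoid[OF ring_mat])

context
  fixes G :: "('a, 'b) monoid_scheme" and n \<rho>
  assumes G: "group G" and rho: "\<rho> \<in> hom G (GL_complex n)"
begin

lemma rep_carrier: "g \<in> carrier G \<Longrightarrow> \<rho> g \<in> carrier_mat n n"
  using rho unfolding hom_def GL_complex_simps by (auto simp: Units_def ring_mat_simps Pi_def)

lemma rep_mult: "g \<in> carrier G \<Longrightarrow> h \<in> carrier G \<Longrightarrow> \<rho> (g \<otimes>\<^bsub>G\<^esub> h) = \<rho> g * \<rho> h"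
  using hom_mult[OF rho] by (simp add: GL_complex_simps)

lemma rep_one: "\<rho> \<one>\<^bsub>G\<^esub> = 1\<^sub>m n"
  using hom_one[OF rho G group_GL_complex] by (simp add: GL_complex_simps)

lemma rep_eigenvector_pow:
  assumes g: "g \<in> carrier G" and v: "v \<in> carrier_vec n" "\<rho> g *\<^sub>v v = e \<cdot>\<^sub>v v"
  shows "\<rho> (g [^]\<^bsub>G\<^esub> (k::nat)) *\<^sub>v v = e ^ k \<cdot>\<^sub>v v"
proof -
  interpret group G by (rule G)
  show ?thesis
  proof (induction k)
    case 0
    then show ?case using v by (simp add: rep_one)
  next
    case (Suc k)
    have "\<rho> (g [^]\<^bsub>G\<^esub> Suc k) *\<^sub>v v = \<rho> (g [^]\<^bsub>G\<^esub> k) *\<^sub>v (\<rho> g *\<^sub>v v)"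
      using g v rep_carrier by (simp add: rep_mult assoc_mult_mat_vec[of _ n n _ n])
    also have "\<dots> = e \<cdot>\<^sub>v (\<rho> (g [^]\<^bsub>G\<^esub> k) *\<^sub>v v)"
      unfolding v(2) using g v(1) by (intro mult_mat_vec[of _ n n]) (auto intro: rep_carrier)
    also have "\<dots> = e ^ Suc k \<cdot>\<^sub>v v" using Suc by (simp add: smult_smult_assoc)
    finally show ?case .
  qed
qed

lemma rep_eigenvalue_root_of_unity:
  assumes fin: "finite (carrier G)" and g: "g \<in> carrier G" and e: "eigenvalue (\<rho> g) e"
  shows "e ^ Coset.order G = 1"
proof -
  interpret group G by (rule G)
  have dr: "dim_row (\<rho> g) = n" using rep_carrier[OF g] by auto
  obtain v where v: "v \<in> carrier_vec n" "v \<noteq> 0\<^sub>v n" "\<rho> g *\<^sub>v v = e \<cdot>\<^sub>v v"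
    using e unfolding eigenvalue_def eigenvector_def dr by blast
  have "e ^ Coset.order G \<cdot>\<^sub>v v = v"
    using rep_eigenvector_pow[OF g v(1,3), of "Coset.order G"] pow_order_eq_1[OF g] v(1)
    by (simp add: rep_one)
  moreover obtain i where "i < n" "v $ i \<noteq> 0"
    using v(1,2) eq_vecI[of v "0\<^sub>v n"] by auto
  ultimately show ?thesis using v(1)
    by (metis index_smult_vec(1) carrier_vecD mult_cancel_right1 )
qed

lemma rep_character_one: "rep_character G \<rho> \<one>\<^bsub>G\<^esub> = of_nat n"
proof -
  interpret group G by (rule G)
  show ?thesis by (simp add: rep_character_def rep_one mat_trace_def)
qed

end

lemma complex_subspaceI:
  assumes "W \<subseteq> carrier_vec n" "0\<^sub>v n \<in> W"
    and "\<And>v w. v \<in> W \<Longrightarrow> w \<in> W \<Longrightarrow> v + w \<in> W" "\<And>c v. v \<in> W \<Longrightarrow> c \<cdot>\<^sub>v v \<in> W"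
  shows "VectorSpace.subspace class_ring W (module_vec TYPE(complex) n)"
  unfolding VectorSpace.subspace_def submodule_def
  using assms by (auto simp: vec_vs vec_module module_vec_simps)

lemma complex_subspaceD:
  assumes "VectorSpace.subspace class_ring W (module_vec TYPE(complex) n)"
  shows "W \<subseteq> carrier_vec n" "0\<^sub>v n \<in> W"
    and "v \<in> W \<Longrightarrow> w \<in> W \<Longrightarrow> v + w \<in> W" "v \<in> W \<Longrightarrow> c \<cdot>\<^sub>v v \<in> W"
  using assms unfolding VectorSpace.subspace_def submodule_def by (auto simp: module_vec_simps)

text \<open>The orbit of a nonzero vector spans a nonzero invariant subspace, hence the whole
space.\<close>
lemma irreducible_rep_dim_le:
  assumes G: "group G" and fin: "finite (carrier G)" and irr: "irreducible_rep G n \<rho>"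
  shows "n \<le> Coset.order G"
proof -
  interpret group G by (rule G)
  interpret V: vec_space "TYPE(complex)" n .
  from irr have n0: "n > 0" and rho: "\<rho> \<in> hom G (GL_complex n)"
    and inv: "\<And>W. VectorSpace.subspace class_ring W (module_vec TYPE(complex) n) \<Longrightarrow>
          (\<forall>g\<in>carrier G. \<forall>w\<in>W. \<rho> g *\<^sub>v w \<in> W) \<Longrightarrow> W = {0\<^sub>v n} \<or> W = carrier_vec n"
    unfolding irreducible_rep_def by auto
  note rc = rep_carrier[OF G rho]
  define v where "v = (unit_vec n 0 :: complex vec)"
  have v: "v \<in> carrier_vec n" "v \<noteq> 0\<^sub>v n" using n0 by (auto simp: v_def)
  define S where "S = (\<lambda>g. \<rho> g *\<^sub>v v) ` carrier G"
  have S: "S \<subseteq> carrier_vec n" "finite S" using mult_mat_vec_carrier[OF rc v(1)] fin by (auto simp: S_def)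
  have sub: "VectorSpace.subspace class_ring (V.span S) (module_vec TYPE(complex) n)"
    by (rule V.span_is_subspace[OF S(1)])
  have "\<rho> h *\<^sub>v w \<in> V.span S" if h: "h \<in> carrier G" and w: "w \<in> V.span S" for h w
  proof -
    let ?N = "{w \<in> carrier_vec n. \<rho> h *\<^sub>v w \<in> V.span S}"
    have rh0: "\<rho> h *\<^sub>v 0\<^sub>v n = 0\<^sub>v n" using rc[OF h] by auto
    have "VectorSpace.subspace class_ring ?N (module_vec TYPE(complex) n)"
    proof (rule complex_subspaceI)
      show "0\<^sub>v n \<in> ?N" using complex_subspaceD(2)[OF sub] rh0 by simp
    next
      fix v w assume "v \<in> ?N" "w \<in> ?N"
      then show "v + w \<in> ?N"
        using mult_add_distrib_mat_vec[OF rc[OF h], of v w] complex_subspaceD(3)[OF sub] by simp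
    next
      fix c v assume "v \<in> ?N"
      then show "c \<cdot>\<^sub>v v \<in> ?N"
        using mult_mat_vec[OF rc[OF h], of v c] complex_subspaceD(4)[OF sub] by simp
    qed blast
    moreover have "S \<subseteq> ?N"
    proof
      fix s assume "s \<in> S"
      then obtain g where g: "g \<in> carrier G" "s = \<rho> g *\<^sub>v v" by (auto simp: S_def)
      have "\<rho> h *\<^sub>v s = \<rho> (h \<otimes>\<^bsub>G\<^esub> g) *\<^sub>v v"
        using g h v rc by (simp add: rep_mult[OF G rho] assoc_mult_mat_vec[of _ n n _ n])
      also have "\<dots> \<in> S" using g h by (auto simp: S_def)
      finally show "s \<in> ?N" using V.in_own_span[OF S(1)] \<open>s \<in> S\<close> S(1) by auto
    qed
    ultimately have "V.span S \<subseteq> ?N"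
      using V.span_is_subset[of S ?N] by (simp add: VectorSpace.subspace_def)
    then show ?thesis using w by auto
  qed
  then have "V.span S = {0\<^sub>v n} \<or> V.span S = carrier_vec n"
    using inv[OF sub] by blast
  moreover have "v \<in> V.span S"
  proof -
    have "v = \<rho> \<one>\<^bsub>G\<^esub> *\<^sub>v v" using v by (simp add: rep_one[OF G rho])
    then have "v \<in> S" by (auto simp: S_def)
    then show ?thesis using V.in_own_span[OF S(1)] by auto
  qed
  ultimately have "V.span S = carrier_vec n" using v by auto
  then have "V.dim \<le> card S" using V.gen_ge_dim[OF S(2,1)] by simp
  also have "\<dots> \<le> card (carrier G)" unfolding S_def by (rule card_image_le[OF fin])
  finally show ?thesis by (simp add: V.dim_is_n Coset.order_def)
qed

text \<open>A character value is a sum of at most \<open>|G|\<close> many \<open>|G|\<close>-th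
roots of unity, so only finitely many values occur at all. Finiteness is what makes the sum of
codegrees a genuine sum: a sum over an infinite set would be \<open>0\<close>.\<close>
lemma finite_Irr:
  assumes G: "group G" and fin: "finite (carrier G)"
  shows "finite (Irr G)"
proof -
  interpret group G by (rule G)
  let ?N = "Coset.order G"
  have N: "?N > 0" using fin order_gt_0_iff_finite by blast
  let ?R = "{e :: complex. e ^ ?N = 1}"
  have R: "finite ?R" by (rule finite_roots_unity) (use N in auto)
  define F where "F = sum_list ` {es. set es \<subseteq> ?R \<and> length es \<le> ?N}"
  have F: "finite F" unfolding F_def by (intro finite_imageI finite_lists_length_le R)
  have "Irr G \<subseteq> (carrier G \<rightarrow>\<^sub>E F)"
  proof
    fix \<psi> assume "\<psi> \<in> Irr G"
    then obtain \<rho> n where irr: "irreducible_rep G n \<rho>" and chi: "\<psi> = rep_character G \<rho>"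
      by (auto simp: Irr_def)
    have rho: "\<rho> \<in> hom G (GL_complex n)" using irr by (auto simp: irreducible_rep_def)
    show "\<psi> \<in> carrier G \<rightarrow>\<^sub>E F"
    proof
      fix g assume g: "g \<in> carrier G"
      obtain es where es: "length es = n" "\<And>e. e \<in> set es \<Longrightarrow> eigenvalue (\<rho> g) e"
        "mat_trace (\<rho> g) = sum_list es"
        using trace_eq_sum_eigenvalues[OF rep_carrier[OF G rho g]] by blast
      have "set es \<subseteq> ?R"
        using es(2) rep_eigenvalue_root_of_unity[OF G rho fin g] by auto
      then show "\<psi> g \<in> F"
        using irreducible_rep_dim_le[OF G fin irr] es g unfolding chi rep_character_def F_def by auto
    qed (auto simp: chi rep_character_def)
  qed
  then show ?thesis using fin F by (meson finite_PiE finite_subset)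
qed

lemma codegree_nonneg:
  assumes G: "group G" and "\<psi> \<in> Irr G"
  shows "codegree G \<psi> \<ge> 0"
proof -
  obtain \<rho> n where irr: "irreducible_rep G n \<rho>" and chi: "\<psi> = rep_character G \<rho>"
    using assms by (auto simp: Irr_def)
  have rho: "\<rho> \<in> hom G (GL_complex n)" using irr by (auto simp: irreducible_rep_def)
  show ?thesis unfolding codegree_def chi rep_character_one[OF G rho] by simp
qed


section \<open>The sum of codegrees of a cyclic group\<close>

text \<open>An eigenvector of the generator spans an invariant line.\<close>
lemma cyclic_irreducible_rep_linear:
  assumes n: "n \<ge> 2" and irr: "irreducible_rep (integer_mod_group n) m \<rho>"
  obtains z :: complex where "m = 1" "z ^ n = 1"
    "rep_character (integer_mod_group n) \<rho> = (\<lambda>k\<in>carrier (integer_mod_group n). z ^ nat k)"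
proof -
  let ?G = "integer_mod_group n"
  have G: "group ?G" by simp
  interpret group ?G by (rule G)
  have fin: "finite (carrier ?G)" and ord: "Coset.order ?G = n"
    using n by (auto simp: carrier_integer_mod_group Coset.order_def)
  from irr have m0: "m > 0" and rho: "\<rho> \<in> hom ?G (GL_complex m)"
    and inv: "\<And>W. VectorSpace.subspace class_ring W (module_vec TYPE(complex) m) \<Longrightarrow>
          (\<forall>g\<in>carrier ?G. \<forall>w\<in>W. \<rho> g *\<^sub>v w \<in> W) \<Longrightarrow> W = {0\<^sub>v m} \<or> W = carrier_vec m"
    unfolding irreducible_rep_def by auto
  have one: "1 \<in> carrier ?G" using n by simp
  note rc = rep_carrier[OF G rho]
  obtain es where es: "length es = m" "\<And>e. e \<in> set es \<Longrightarrow> eigenvalue (\<rho> 1) e"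
    using trace_eq_sum_eigenvalues[OF rc[OF one]] by blast
  then obtain z where ev: "eigenvalue (\<rho> 1) z" using m0 by (cases es) auto
  have zn: "z ^ n = 1" using rep_eigenvalue_root_of_unity[OF G rho fin one ev] ord by simp
  have dr: "dim_row (\<rho> 1) = m" using rc[OF one] by auto
  obtain v where v: "v \<in> carrier_vec m" "v \<noteq> 0\<^sub>v m" "\<rho> 1 *\<^sub>v v = z \<cdot>\<^sub>v v"
    using ev unfolding eigenvalue_def eigenvector_def dr by blast
  have act: "\<rho> k *\<^sub>v v = z ^ nat k \<cdot>\<^sub>v v" if k: "k \<in> carrier ?G" for k
  proof -
    have "1 [^]\<^bsub>?G\<^esub> nat k = k" using k n by (auto simp: carrier_integer_mod_group)
    then show ?thesis using rep_eigenvector_pow[OF G rho one v(1,3), of "nat k"] by simp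
  qed
  define W where "W = {c \<cdot>\<^sub>v v | c. True}"
  have sub: "VectorSpace.subspace class_ring W (module_vec TYPE(complex) m)"
  proof (rule complex_subspaceI)
    have "0\<^sub>v m = 0 \<cdot>\<^sub>v v" using v(1) by auto
    then show "0\<^sub>v m \<in> W" unfolding W_def by blast
  qed (use v(1) in \<open>auto simp: W_def smult_smult_assoc add_smult_distrib_vec[symmetric]\<close>)
  have "\<forall>g\<in>carrier ?G. \<forall>w\<in>W. \<rho> g *\<^sub>v w \<in> W"
  proof safe
    fix g w assume g: "g \<in> carrier ?G" and "w \<in> W"
    then obtain c where "w = c \<cdot>\<^sub>v v" by (auto simp: W_def)
    then have "\<rho> g *\<^sub>v w = (c * z ^ nat g) \<cdot>\<^sub>v v"
      using mult_mat_vec[OF rc[OF g] v(1)] act[OF g] by (simp add: smult_smult_assoc)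
    then show "\<rho> g *\<^sub>v w \<in> W" by (auto simp: W_def)
  qed
  then have "W = {0\<^sub>v m} \<or> W = carrier_vec m" using inv[OF sub] by blast
  moreover have "v \<in> W" unfolding W_def by (auto intro!: exI[of _ 1])
  ultimately have W: "W = carrier_vec m" using v by auto
  have m1: "m = 1"
  proof (rule ccontr)
    assume "m \<noteq> 1"
    then have m2: "m > 1" using m0 by simp
    obtain c d where cd: "unit_vec m 0 = c \<cdot>\<^sub>v v" "unit_vec m 1 = d \<cdot>\<^sub>v v"
    proof -
      have "unit_vec m 0 \<in> W" "unit_vec m 1 \<in> W" unfolding W by simp_all
      then show ?thesis using that unfolding W_def by blast
    qed
    have "(c \<cdot>\<^sub>v v) $ 0 = 1" "(c \<cdot>\<^sub>v v) $ 1 = 0" "(d \<cdot>\<^sub>v v) $ 1 = 1"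
      unfolding cd[symmetric] using m2 by auto
    then show False using v(1) m2 by auto
  qed
  have v0: "v $ 0 \<noteq> 0" using v(1,2) m1 eq_vecI[of v "0\<^sub>v m"] by auto
  have "mat_trace (\<rho> k) = z ^ nat k" if k: "k \<in> carrier ?G" for k
  proof -
    have c: "\<rho> k \<in> carrier_mat 1 1" using rc[OF k] m1 by simp
    have "(\<rho> k *\<^sub>v v) $ 0 = \<rho> k $$ (0,0) * v $ 0"
      using c v(1) m1 by (simp add: scalar_prod_def)
    moreover have "(\<rho> k *\<^sub>v v) $ 0 = z ^ nat k * v $ 0" using act[OF k] v(1) m1 by simp
    ultimately have "\<rho> k $$ (0,0) = z ^ nat k" using v0 by simp
    then show ?thesis using c by (simp add: mat_trace_def)
  qed
  then have "rep_character ?G \<rho> = (\<lambda>k\<in>carrier ?G. z ^ nat k)"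
    unfolding rep_character_def by (intro restrict_ext) auto
  with m1 zn show ?thesis using that by blast
qed

text \<open>The characters are \<open>j \<mapsto> w ^ (k * j)\<close> for a primitive
\<open>n\<close>-th root of unity \<open>w\<close>, and the kernel of the \<open>k\<close>-th one
has order \<open>gcd k n\<close>. Its codegree is thus \<open>n div gcd k n\<close>, the order of
\<open>k\<close> in the cyclic group, and each divisor \<open>d\<close> of \<open>n\<close> is the
order of \<open>totient d\<close> elements. For the inequality, the kernel is estimated from below
by the multiples of \<open>n div gcd k n\<close>.\<close>
lemma sum_codegrees_cyclic_le:
  assumes n: "n \<ge> 2"
  shows "sum_codegrees (integer_mod_group n) \<le> (\<Sum>d | d dvd n. real (d * totient d))"
proof -
  let ?G = "integer_mod_group n"
  have G: "group ?G" by simp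
  interpret group ?G by (rule G)
  have car: "carrier ?G = {0..<int n}" using n by (simp add: carrier_integer_mod_group)
  have fin: "finite (carrier ?G)" by (simp add: car)
  have ord: "Coset.order ?G = n" by (simp add: Coset.order_def car)
  define w where "w = cis (2 * pi / real n)"
  have wn: "w ^ n = 1" using n by (simp add: w_def DeMoivre)
  have w_pow: "w ^ k = cis (2 * pi * real k / real n)" for k
    unfolding w_def DeMoivre by (simp add: mult.commute)
  have w1: "w ^ m = 1" if "n dvd m" for m
    using that wn by (metis dvdE power_mult power_one)
  define z where "z k = w ^ k" for k
  have zn: "z k ^ n = 1" for k
    unfolding z_def power_mult[symmetric] by (rule w1) simp
  have zmod: "z k ^ (m mod n) = z k ^ m" for k m
  proof -
    have "z k ^ m = (z k ^ n) ^ (m div n) * z k ^ (m mod n)"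
      unfolding power_mult[symmetric] power_add[symmetric] by simp
    then show ?thesis by (simp add: zn)
  qed
  define X where "X k = (\<lambda>j\<in>carrier ?G. z k ^ nat j)" for k
  have "Irr ?G \<subseteq> X ` {0<..n}"
  proof
    fix \<psi> assume "\<psi> \<in> Irr ?G"
    then obtain \<rho> m where "irreducible_rep ?G m \<rho>" and chi: "\<psi> = rep_character ?G \<rho>"
      by (auto simp: Irr_def)
    then obtain y where y: "y ^ n = 1" "\<psi> = (\<lambda>j\<in>carrier ?G. y ^ nat j)"
      using cyclic_irreducible_rep_linear[OF n] by metis
    have "y \<in> (\<lambda>k. cis (2 * pi * real k / real n)) ` {..<n}"
      using bij_betw_imp_surj_on[OF bij_betw_roots_unity[of n]] n y(1) by simp
    then obtain k where k: "k < n" "y = z k"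
      unfolding z_def w_pow by blast
    show "\<psi> \<in> X ` {0<..n}"
    proof (cases "k = 0")
      case True
      then have "y = z n" using k wn by (simp add: z_def)
      then show ?thesis using y n unfolding X_def by auto
    next
      case False
      then show ?thesis using k y unfolding X_def by auto
    qed
  qed
  have cod: "codegree ?G (X k) \<le> real (n div gcd k n)" if k: "k \<in> {0<..n}" for k
  proof -
    let ?g = "gcd k n"
    have g0: "?g > 0" using k by simp
    let ?K = "char_kernel ?G (X k)"
    have Keq: "?K = {j \<in> {0..<int n}. z k ^ nat j = 1}"
      using n by (auto simp: char_kernel_def X_def car)
    have sg: "subgroup ?K ?G"
    proof (rule subgroupI)
      have "0 \<in> ?K" using n by (simp add: Keq)
      then show "?K \<noteq> {}" by blast
      show "?K \<subseteq> carrier ?G" by (auto simp: Keq car)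
    next
      fix a b assume ab: "a \<in> ?K" "b \<in> ?K"
      then have "z k ^ nat ((a + b) mod int n) = z k ^ nat a * z k ^ nat b"
        using zmod[of k "nat (a + b)"] nat_mod_distrib[of "a + b" "int n"]
        by (auto simp: Keq nat_add_distrib power_add)
      then show "a \<otimes>\<^bsub>?G\<^esub> b \<in> ?K" using ab n by (simp add: Keq)
    next
      fix a assume a: "a \<in> ?K"
      have "z k ^ nat (- a mod int n) = z k ^ (nat (- a mod int n) + nat a)"
        using a by (simp add: Keq power_add)
      also have "nat (- a mod int n) + nat a = nat (- a mod int n + a)"
        using a n by (simp add: Keq nat_add_distrib)
      also have "z k ^ nat (- a mod int n + a) = z k ^ (nat ((- a mod int n + a) mod int n))"
        by (subst nat_mod_distrib) (use a n in \<open>auto simp: Keq zmod\<close>)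
      also have "\<dots> = 1" by (simp add: mod_simps)
      finally show "inv\<^bsub>?G\<^esub> a \<in> ?K" using a n car by (simp add: Keq)
    qed
    have lag: "card (rcosets\<^bsub>?G\<^esub> ?K) * card ?K = n"
      using lagrange[OF sg] ord by simp
    have "(\<lambda>i. int (i * (n div ?g))) ` {..<?g} \<subseteq> ?K"
    proof safe
      fix i assume i: "i < ?g"
      have "k * (n div ?g) = n * (k div ?g)"
        using div_mult_swap[of ?g n k] div_mult_swap[of ?g k n] by (simp add: mult.commute[of k n])
      then have "n dvd k * (n div ?g) * i" by simp
      then have "n dvd k * (i * (n div ?g))" by (simp only: mult_ac)
      then have "z k ^ (i * (n div ?g)) = 1"
        unfolding z_def power_mult[symmetric] by (rule w1)
      moreover have "i * (n div ?g) < n"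
      proof -
        have e: "?g * (n div ?g) = n" by simp
        then have "n div ?g > 0" using n by (intro gr0I) simp
        then have "i * (n div ?g) < ?g * (n div ?g)" using i by (rule mult_less_mono1[rotated])
        then show ?thesis unfolding e .
      qed
      ultimately show "int (i * (n div ?g)) \<in> ?K"
        unfolding Keq by (simp del: of_nat_mult)
    qed
    then have "card ((\<lambda>i. int (i * (n div ?g))) ` {..<?g}) \<le> card ?K"
      by (rule card_mono[rotated]) (use finite_subset[OF _ fin] in \<open>auto simp: char_kernel_def\<close>)
    also have "card ((\<lambda>i. int (i * (n div ?g))) ` {..<?g}) = ?g"
    proof -
      have "n div ?g \<noteq> 0" using n by (simp add: dvd_div_eq_0_iff)
      then show ?thesis by (subst card_image) (auto simp: inj_on_def)
    qed
    finally have gle: "?g \<le> card ?K" .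
    have "card (rcosets\<^bsub>?G\<^esub> ?K) * ?g \<le> n" using lag gle by (metis mult_le_mono2)
    then have "card (rcosets\<^bsub>?G\<^esub> ?K) \<le> n div ?g"
      using g0 by (simp add: less_eq_div_iff_mult_less_eq)
    moreover have "X k \<one>\<^bsub>?G\<^esub> = 1" using n by (simp add: X_def car)
    ultimately show ?thesis by (simp add: codegree_def)
  qed
  have "sum_codegrees ?G \<le> (\<Sum>k\<in>{0<..n}. codegree ?G (X k))"
  proof -
    have nn: "codegree ?G (X k) \<ge> 0" for k
      using n by (simp add: codegree_def X_def car)
    have "sum_codegrees ?G \<le> sum (codegree ?G) (X ` {0<..n})"
      unfolding sum_codegrees_def
      by (rule sum_mono2) (use nn \<open>Irr ?G \<subseteq> X ` {0<..n}\<close> in auto)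
    also have "\<dots> \<le> (\<Sum>k\<in>{0<..n}. codegree ?G (X k))"
      using sum_image_le[of "{0<..n}" "codegree ?G" X] nn by (simp add: o_def)
    finally show ?thesis .
  qed
  also have "\<dots> \<le> (\<Sum>k\<in>{0<..n}. real (n div gcd k n))"
    by (rule sum_mono) (rule cod)
  also have "\<dots> = (\<Sum>d | d dvd n. \<Sum>k\<in>{k\<in>{0<..n}. gcd k n = d}. real (n div gcd k n))"
    by (rule sum.group[symmetric]) (use n in auto)
  also have "\<dots> = (\<Sum>d | d dvd n. real ((n div d) * totient (n div d)))"
  proof (rule sum.cong[OF refl])
    fix d assume "d \<in> {d. d dvd n}"
    then have "card {k\<in>{0<..n}. gcd k n = d} = totient (n div d)"
      using n by (intro card_gcd_eq_totient) auto
    moreover have "(\<Sum>k\<in>{k\<in>{0<..n}. gcd k n = d}. real (n div gcd k n))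
        = (\<Sum>k\<in>{k\<in>{0<..n}. gcd k n = d}. real (n div d))"
      by (rule sum.cong) auto
    ultimately show "(\<Sum>k\<in>{k\<in>{0<..n}. gcd k n = d}. real (n div gcd k n))
        = real ((n div d) * totient (n div d))" by simp
  qed
  also have "\<dots> = (\<Sum>d | d dvd n. real (d * totient d))"
  proof -
    have "n div (n div d) = d" if "d dvd n" for d using that n by (auto elim!: dvdE)
    then show ?thesis
      by (intro sum.reindex_bij_witness[of _ "\<lambda>d. n div d" "\<lambda>d. n div d"]) auto
  qed
  finally show ?thesis .
qed




text \<open>The trivial character contributes a positive term. Positivity is needed to divide by
the sum of codegrees of the cyclic group.\<close>
lemma sum_codegrees_pos:
  assumes G: "group G" and fin: "finite (carrier G)"
  shows "sum_codegrees G > 0"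
proof -
  interpret group G by (rule G)
  let ?\<rho> = "\<lambda>g. 1\<^sub>m 1 :: complex mat"
  have one: "monoid.one (GL_complex 1) = 1\<^sub>m 1" by (simp add: GL_complex_simps)
  interpret GL: group "GL_complex 1" by (rule group_GL_complex)
  have rho: "?\<rho> \<in> hom G (GL_complex 1)"
    using GL.one_closed one unfolding hom_def by (simp add: GL_complex_simps)
  have irr: "irreducible_rep G 1 ?\<rho>"
    unfolding irreducible_rep_def
  proof (intro conjI rho allI impI)
    fix W assume "VectorSpace.subspace class_ring W (module_vec TYPE(complex) 1) \<and>
      (\<forall>g\<in>carrier G. \<forall>w\<in>W. 1\<^sub>m 1 *\<^sub>v w \<in> W)"
    then have sub: "VectorSpace.subspace class_ring W (module_vec TYPE(complex) 1)" by blast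
    note W = complex_subspaceD[OF sub]
    show "W = {0\<^sub>v 1} \<or> W = carrier_vec 1"
    proof (rule disjCI)
      assume "W \<noteq> carrier_vec 1"
      then obtain u where u: "u \<in> carrier_vec 1" "u \<notin> W" using W(1) by blast
      have "w = 0\<^sub>v 1" if w: "w \<in> W" for w
      proof (rule ccontr)
        assume "w \<noteq> 0\<^sub>v 1"
        moreover have wc: "w \<in> carrier_vec 1" using w W(1) by blast
        ultimately have "w $ 0 \<noteq> 0" using eq_vecI[of w "0\<^sub>v 1"] by auto
        then have "u = (u $ 0 / w $ 0) \<cdot>\<^sub>v w" using u(1) wc by (intro eq_vecI) auto
        then show False using W(4)[OF w] u(2) by metis
      qed
      then show "W = {0\<^sub>v 1}" using W(2) by blast
    qed
  qed simp
  let ?\<psi> = "rep_character G ?\<rho>"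
  have chi: "?\<psi> \<in> Irr G" using irr by (auto simp: Irr_def)
  have "char_kernel G ?\<psi> = carrier G"
    by (auto simp: char_kernel_def rep_character_def)
  moreover have "card (rcosets\<^bsub>G\<^esub> carrier G) > 0"
    using lagrange[OF subgroup_self] fin order_gt_0_iff_finite by (intro gr0I) auto
  ultimately have "codegree G ?\<psi> > 0"
    unfolding codegree_def rep_character_one[OF G rho] by simp
  also have "codegree G ?\<psi> \<le> sum_codegrees G"
    unfolding sum_codegrees_def
    by (rule member_le_sum[OF chi]) (use finite_Irr[OF G fin] codegree_nonneg[OF G] in auto)
  finally show ?thesis .
qed



text \<open>Every divisor of \<open>a * b\<close> is a product of a divisor of \<open>a\<close>
and a divisor of \<open>b\<close>. The totient is multiplicative on such products because the two
divisors are coprime.\<close>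
lemma divisor_totient_sum_mult_le:
  assumes "coprime a b" "a > 0" "b > 0"
  shows "(\<Sum>d | d dvd a * b. real (d * totient d)) \<le>
    (\<Sum>d | d dvd a. real (d * totient d)) * (\<Sum>d | d dvd b. real (d * totient d))"
proof -
  let ?f = "\<lambda>d. real (d * totient d)" and ?m = "\<lambda>(x,y). x * y :: nat"
  let ?D = "{d. d dvd a} \<times> {d. d dvd b}"
  have fin: "finite ?D" using assms by auto
  have "{d. d dvd a * b} \<subseteq> ?m ` ?D" 
  proof
    fix d assume "d \<in> {d. d dvd a * b}"
    then obtain x y where "d = x * y" "x dvd a" "y dvd b" using division_decomp[of d a b] by blast
    then show "d \<in> ?m ` ?D" by (intro image_eqI[of _ _ "(x, y)"]) simp_all
  qed
  then have "(\<Sum>d | d dvd a * b. ?f d) \<le> sum ?f (?m ` ?D)"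
    using fin by (intro sum_mono2) auto
  also have "\<dots> \<le> (\<Sum>x\<in>?D. ?f (?m x))"
    using sum_image_le[OF fin, of ?f ?m] by (simp add: o_def)
  also have "\<dots> = (\<Sum>x\<in>?D. ?f (fst x) * ?f (snd x))"
  proof (rule sum.cong[OF refl])
    fix x assume x: "x \<in> ?D"
    then have "coprime (fst x) (snd x)"
      by (intro coprime_divisors[OF _ _ assms(1)]) auto
    then show "?f (?m x) = ?f (fst x) * ?f (snd x)"
      by (simp add: case_prod_beta totient_mult_coprime)
  qed
  also have "\<dots> = (\<Sum>d | d dvd a. ?f d) * (\<Sum>d | d dvd b. ?f d)"
    unfolding sum_product sum.cartesian_product by (simp add: case_prod_beta)
  finally show ?thesis .
qed

lemma divisor_totient_sum_prime_square:
  assumes "prime (p::nat)"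
  shows "(\<Sum>d | d dvd p^2. real (d * totient d)) = real p^4 - real p^3 + real p^2 - real p + 1"
proof -
  have p1: "p > 1" using assms prime_gt_1_nat by blast
  have "{d. d dvd p^2} = {1, p, p^2}"
  proof -
    have "d dvd p^2 \<longleftrightarrow> d = p^0 \<or> d = p^1 \<or> d = p^2" for d
    proof -
      have "k \<le> 2 \<longleftrightarrow> k = 0 \<or> k = 1 \<or> k = 2" for k :: nat by linarith
      then show ?thesis using divides_primepow_nat[OF assms, of d 2] by metis
    qed
    then show ?thesis by auto
  qed
  moreover have "totient (p^2) = p * (p - 1)"
    using totient_prime_power_Suc[OF assms, of 1] by (simp add: power2_eq_square)
  moreover have "Suc 0 \<noteq> p" "Suc 0 \<noteq> p^2" "p \<noteq> p^2" using p1 by (auto simp: power2_eq_square)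
  ultimately have "(\<Sum>d | d dvd p^2. real d * real (totient d))
      = 1 + real p * (real p - 1) + (real p)\<^sup>2 * (real p * (real p - 1))"
    using p1 totient_prime[OF assms] by (simp add: of_nat_diff mult_ac)
  also have "\<dots> = real p^4 - real p^3 + real p^2 - real p + 1"
    by (simp add: algebra_simps power2_eq_square power3_eq_cube power4_eq_xxxx)
  finally show ?thesis by simp
qed

text \<open>The factor \<open>7 = 1 + 3 * totient 3\<close> comes from the prime
\<open>3\<close>.\<close>
lemma divisor_totient_sum_le:
  assumes "inj_on q {..<t::nat}" "\<And>i. i < t \<Longrightarrow> prime (q i)" "\<And>i. i < t \<Longrightarrow> q i \<noteq> 3"
  shows "(\<Sum>d | d dvd 3 * (\<Prod>i<t. (q i)^2). real (d * totient d)) \<le>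
     7 * (\<Prod>i<t. real (q i)^4 - real (q i)^3 + real (q i)^2 - real (q i) + 1)"
  using assms
proof (induction t)
  case 0
  have "{d. d dvd (3::nat)} = {1, 3}"
  proof -
    have "prime (3::nat)" by simp
    then show ?thesis unfolding prime_nat_iff by auto
  qed
  moreover have "totient 3 = 2" using totient_prime[of 3] by simp
  ultimately show ?case by simp
next
  case (Suc t)
  let ?m = "3 * (\<Prod>i<t. (q i)^2)"
  have p: "prime (q t)" "q t \<noteq> 3" using Suc.prems by auto
  have "coprime (q t) (q i)" if "i < t" for i
  proof -
    have "q t \<noteq> q i" using inj_onD[OF Suc.prems(1), of t i] that by auto
    then show ?thesis using that Suc.prems(2) by (intro primes_coprime) auto
  qed
  then have "coprime (q t) (\<Prod>i<t. (q i)^2)" by (intro prod_coprime_right) simp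
  moreover have "coprime (q t) 3" using p by (intro primes_coprime) simp_all
  ultimately have "coprime ?m ((q t)^2)" by (simp add: coprime_commute)
  moreover have "?m > 0" using Suc.prems(2) by (auto simp: prime_gt_0_nat intro!: prod_pos)
  ultimately have "(\<Sum>d | d dvd ?m * (q t)^2. real (d * totient d)) \<le>
      (\<Sum>d | d dvd ?m. real (d * totient d)) * (\<Sum>d | d dvd (q t)^2. real (d * totient d))"
    using p(1) prime_gt_0_nat by (intro divisor_totient_sum_mult_le) auto
  also have "\<dots> \<le> 7 * (\<Prod>i<t. real (q i)^4 - real (q i)^3 + real (q i)^2 - real (q i) + 1)
       * (\<Sum>d | d dvd (q t)^2. real (d * totient d))"
    
  proof (rule mult_right_mono)
    show "(\<Sum>d | d dvd ?m. real (d * totient d)) \<le>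
        7 * (\<Prod>i<t. real (q i)^4 - real (q i)^3 + real (q i)^2 - real (q i) + 1)"
      by (rule Suc.IH) (use Suc.prems inj_on_subset[OF Suc.prems(1), of "{..<t}"] in auto)
  qed (auto intro: sum_nonneg)
  finally show ?case
    unfolding divisor_totient_sum_prime_square[OF p(1)] by (simp add: mult_ac)
qed

section \<open>Characters induced from the kernel of a Frobenius group\<close>

text \<open>A Frobenius group with abelian kernel \<open>A\<close> and cyclic complement of order
\<open>q\<close>, presented by a generator \<open>x\<close> of the complement. The powers \<open>x
[^] j\<close> with \<open>j < q\<close> represent the cosets of \<open>A\<close> and index the
rows and columns of the induced matrices.\<close>
locale frobenius_cyclic_complement = group G for G (structure) +
  fixes A :: "'a set" and x :: 'a and q :: nat
  assumes fin: "finite (carrier G)"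
    and A_normal: "A \<lhd> G"
    and A_comm: "a \<in> A \<Longrightarrow> b \<in> A \<Longrightarrow> a \<otimes> b = b \<otimes> a"
    and x_carrier [simp]: "x \<in> carrier G"
    and q_pos: "q > 0"
    and x_pow: "x [^] q = \<one>"
    and decompose: "g \<in> carrier G \<Longrightarrow> \<exists>a\<in>A. \<exists>j<q. g = a \<otimes> x [^] j"
    and x_notin: "0 < j \<Longrightarrow> j < q \<Longrightarrow> x [^] (j::nat) \<notin> A"
    and fixed_point_free: "a \<in> A \<Longrightarrow> 0 < j \<Longrightarrow> j < q \<Longrightarrow> a \<otimes> x [^] (j::nat) = x [^] j \<otimes> a \<Longrightarrow> a = \<one>"
begin

lemma inv_cancel [simp]:
  assumes "y \<in> carrier G" "g \<in> carrier G"
  shows "inv y \<otimes> (y \<otimes> g) = g" "y \<otimes> (inv y \<otimes> g) = g"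
  using assms by (simp_all add: m_assoc[symmetric])

lemma A_subgroup: "subgroup A G"
  using A_normal by (simp add: normal_def)

lemma A_carrier [simp]: "a \<in> A \<Longrightarrow> a \<in> carrier G"
  using subgroup.subset[OF A_subgroup] by blast

lemma A_closed [simp]: "a \<in> A \<Longrightarrow> b \<in> A \<Longrightarrow> a \<otimes> b \<in> A" "\<one> \<in> A" "a \<in> A \<Longrightarrow> inv a \<in> A"
  using A_subgroup by (auto simp: subgroup.m_closed subgroup.one_closed subgroup.m_inv_closed)

lemma finite_A: "finite A"
  using fin by (rule finite_subset[rotated]) auto

lemma A_cancel: "a \<in> A \<Longrightarrow> g \<in> carrier G \<Longrightarrow> a \<otimes> g \<in> A \<longleftrightarrow> g \<in> A"
  using A_closed(1)[of "inv a" "a \<otimes> g"] by auto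

definition twist :: "nat \<Rightarrow> 'a \<Rightarrow> 'a" where
  "twist r g = inv (x [^] r) \<otimes> g \<otimes> x [^] r"

lemma twist_carrier [simp]: "g \<in> carrier G \<Longrightarrow> twist r g \<in> carrier G"
  by (simp add: twist_def)

lemma twist_mult: "g \<in> carrier G \<Longrightarrow> h \<in> carrier G \<Longrightarrow> twist r (g \<otimes> h) = twist r g \<otimes> twist r h"
  by (simp add: twist_def m_assoc)

lemma twist_one [simp]: "twist r \<one> = \<one>"
  by (simp add: twist_def)

lemma twist_inv: "g \<in> carrier G \<Longrightarrow> twist r (inv g) = inv (twist r g)"
  by (simp add: twist_def inv_mult_group m_assoc)

lemma twist_A_iff [simp]: 
  assumes "g \<in> carrier G" shows "twist r g \<in> A \<longleftrightarrow> g \<in> A"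
proof
  assume "twist r g \<in> A"
  then have "x [^] r \<otimes> twist r g \<otimes> inv (x [^] r) \<in> A"
    using normal.inv_op_closed2[OF A_normal] by simp
  also have "x [^] r \<otimes> twist r g \<otimes> inv (x [^] r) = g"
    using assms by (simp add: twist_def m_assoc)
  finally show "g \<in> A" .
next
  assume "g \<in> A"
  then show "twist r g \<in> A" using normal.inv_op_closed1[OF A_normal] by (simp add: twist_def)
qed

lemma twist_0 [simp]: "g \<in> carrier G \<Longrightarrow> twist 0 g = g"
  by (simp add: twist_def)

lemma twist_twist: "g \<in> carrier G \<Longrightarrow> twist r (twist s g) = twist (s + r) g"
  by (simp add: twist_def nat_pow_mult[symmetric] inv_mult_group m_assoc)

lemma twist_q: "g \<in> carrier G \<Longrightarrow> twist q g = g"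
  by (simp add: twist_def x_pow)

lemma twist_fixed: "a \<in> A \<Longrightarrow> 0 < r \<Longrightarrow> r < q \<Longrightarrow> twist r a = a \<Longrightarrow> a = \<one>"
proof -
  assume a: "a \<in> A" "0 < r" "r < q" "twist r a = a"
  have "x [^] r \<otimes> twist r a = a \<otimes> x [^] r" using a(1) by (simp add: twist_def m_assoc)
  then show ?thesis using fixed_point_free[OF a(1,2,3)] a(4) by simp
qed

text \<open>For each \<open>y\<close> there is exactly one \<open>k < q\<close> such that \<open>y
\<otimes> x [^] k\<close> lies in \<open>A\<close>. This is why the induced matrices are
monomial.\<close>
lemma x_pow_unique:
  assumes y: "y \<in> carrier G" and jk: "j < q" "k < q" "y \<otimes> x [^] j \<in> A" "y \<otimes> x [^] k \<in> A"
  shows "j = k"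
proof -
  have *: False if "j < k" "k < q" "y \<otimes> x [^] j \<in> A" "y \<otimes> x [^] k \<in> A" for j k :: nat
  proof -
    have "y \<otimes> x [^] k = y \<otimes> x [^] j \<otimes> x [^] (k - j)"
      using that(1) y by (simp add: m_assoc nat_pow_mult)
    then have "x [^] (k - j) \<in> A" using that(3,4) A_cancel by simp
    then show False using x_notin[of "k - j"] that by simp
  qed
  show ?thesis using *[of j k] *[of k j] jk by (cases j k rule: linorder_cases) auto
qed

lemma x_pow_exists:
  assumes y: "y \<in> carrier G"
  obtains k where "k < q" "y \<otimes> x [^] k \<in> A"
proof -
  obtain a j where a: "a \<in> A" "j < q" "y = a \<otimes> x [^] j" using decompose[OF y] by blast
  show ?thesis
  proof (cases "j = 0")
    case True
    then show ?thesis using a that[of 0] q_pos by simp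
  next
    case False
    have "y \<otimes> x [^] (q - j) = a"
      using a by (simp add: m_assoc nat_pow_mult x_pow)
    then show ?thesis using that[of "q - j"] False a by simp
  qed
qed

lemma order_G: "Coset.order G = q * card A"
proof -
  have "inj_on (\<lambda>(a, j). a \<otimes> x [^] j) (A \<times> {..<q})"
  proof (rule inj_onI, clarsimp)
    fix a j b k assume h: "a \<in> A" "j < q" "b \<in> A" "k < q" "a \<otimes> x [^] j = b \<otimes> x [^] k"
    obtain i where i: "i < q" "x [^] j \<otimes> x [^] i \<in> A" by (rule x_pow_exists[of "x [^] j"]) auto
    have c: "x [^] (j + i) = x [^] (i + j)" "x [^] (k + i) = x [^] (i + k)" by (simp_all add: add.commute)
    have "b \<otimes> (x [^] k \<otimes> x [^] i) = a \<otimes> (x [^] j \<otimes> x [^] i)"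
      using h by (simp add: m_assoc[symmetric])
    then have "b \<otimes> (x [^] k \<otimes> x [^] i) \<in> A" using h i by simp
    then have "x [^] i \<otimes> x [^] k \<in> A" "x [^] i \<otimes> x [^] j \<in> A"
      using h i A_cancel c by (simp_all add: nat_pow_mult)
    then have "j = k" using x_pow_unique[of "x [^] i"] h by simp
    then show "a = b \<and> j = k" using h by simp
  qed
  moreover have "(\<lambda>(a, j). a \<otimes> x [^] j) ` (A \<times> {..<q}) = carrier G"
    using decompose by force
  ultimately show ?thesis
    using card_image[of "\<lambda>(a, j). a \<otimes> x [^] j" "A \<times> {..<q}"]
    by (simp add: Coset.order_def card_cartesian_product mult.commute)
qed

text \<open>Linear characters of \<open>A\<close>, extended by zero to all of \<open>G\<close>.
The extension makes equality of functions coincide with equality of characters, and it turns the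
induced matrices into a uniform formula.\<close>
definition lin_char :: "('a \<Rightarrow> complex) \<Rightarrow> bool" where
  "lin_char l \<longleftrightarrow> (\<forall>a\<in>A. \<forall>b\<in>A. l (a \<otimes> b) = l a * l b) \<and> l \<one> = 1 \<and> (\<forall>g. g \<notin> A \<longrightarrow> l g = 0)"

lemma lin_charD:
  assumes "lin_char l"
  shows "a \<in> A \<Longrightarrow> b \<in> A \<Longrightarrow> l (a \<otimes> b) = l a * l b" "l \<one> = 1" "g \<notin> A \<Longrightarrow> l g = 0"
  using assms by (auto simp: lin_char_def)

lemma lin_char_norm:
  assumes l: "lin_char l" and a: "a \<in> A"
  shows "norm (l a) = 1"
proof -
  have pow: "a [^] (n::nat) \<in> A \<and> l (a [^] n) = l a ^ n" for n
    by (induction n) (use a lin_charD[OF l] in \<open>auto simp: mult.commute\<close>)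
  have "l a ^ Coset.order G = 1"
    using pow[of "Coset.order G"] pow_order_eq_1[of a] a lin_charD(2)[OF l] by simp
  then have "norm (l a) ^ Coset.order G = 1" by (metis norm_one norm_power)
  moreover have "Coset.order G > 0" using fin order_gt_0_iff_finite by blast
  ultimately show ?thesis using power_eq_1_iff[of "norm (l a)" "Coset.order G"] by simp
qed

lemma lin_char_norm_le: "lin_char l \<Longrightarrow> norm (l g) \<le> 1"
  using lin_char_norm[of l g] lin_charD(3)[of l g] by (cases "g \<in> A") auto

lemma lin_char_inv:
  assumes l: "lin_char l" and a: "a \<in> A"
  shows "l a * l (inv a) = 1"
  using lin_charD(1)[OF l a, of "inv a"] lin_charD(2)[OF l] a by simp

text \<open>The representation of \<open>G\<close> induced from \<open>l\<close>, with respect to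
the coset representatives \<open>x [^] s\<close>.\<close>
definition ind_rep :: "('a \<Rightarrow> complex) \<Rightarrow> 'a \<Rightarrow> complex mat" where
  "ind_rep l g = mat q q (\<lambda>(r, s). l (inv (x [^] r) \<otimes> g \<otimes> x [^] s))"

lemma ind_rep_carrier [simp]: "ind_rep l g \<in> carrier_mat q q"
  by (simp add: ind_rep_def)

lemma ind_rep_A:
  assumes l: "lin_char l" and a: "a \<in> A" and rs: "r < q" "s < q"
  shows "l (inv (x [^] r) \<otimes> a \<otimes> x [^] s) = (if r = s then l (twist r a) else 0)"
proof (cases "r = s")
  case False
  have "inv (x [^] r) \<otimes> a \<otimes> x [^] r \<in> A" using twist_A_iff[of a r] a by (simp add: twist_def)
  then have "inv (x [^] r) \<otimes> a \<otimes> x [^] s \<notin> A"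
    using x_pow_unique[of "inv (x [^] r) \<otimes> a" r s] rs a False by auto
  then show ?thesis using False lin_charD(3)[OF l] by simp
qed (simp add: twist_def)

text \<open>In the sum that defines an entry of the product, only the one \<open>k\<close>
survives for which the left factor lies in \<open>A\<close>.\<close>
lemma ind_rep_mult:
  assumes l: "lin_char l" and gh: "g \<in> carrier G" "h \<in> carrier G"
  shows "ind_rep l (g \<otimes> h) = ind_rep l g * ind_rep l h"
proof (rule eq_matI)
  fix r s assume "r < dim_row (ind_rep l g * ind_rep l h)" "s < dim_col (ind_rep l g * ind_rep l h)"
  then have rs: "r < q" "s < q" by (auto simp: ind_rep_def)
  define u where "u k = inv (x [^] r) \<otimes> g \<otimes> x [^] k" for k :: nat
  define v where "v k = inv (x [^] k) \<otimes> h \<otimes> x [^] s" for k :: nat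
  have uv: "u k \<in> carrier G" "v k \<in> carrier G" for k using gh by (auto simp: u_def v_def)
  have uv_eq: "u k \<otimes> v k = inv (x [^] r) \<otimes> (g \<otimes> h) \<otimes> x [^] s" for k
    using gh by (simp add: u_def v_def m_assoc)
  obtain k where k: "k < q" "u k \<in> A"
    using x_pow_exists[of "inv (x [^] r) \<otimes> g"] gh unfolding u_def by auto
  have other: "l (u i) = 0" if "i < q" "i \<noteq> k" for i
    using that k x_pow_unique[of "inv (x [^] r) \<otimes> g" i k] gh lin_charD(3)[OF l] unfolding u_def by auto
  have "(ind_rep l g * ind_rep l h) $$ (r, s) = (\<Sum>i\<in>{0..<q}. l (u i) * l (v i))"
    using rs by (simp add: ind_rep_def scalar_prod_def u_def v_def)
  also have "\<dots> = (\<Sum>i\<in>{0..<q}. if i = k then l (u k) * l (v k) else 0)"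
    by (rule sum.cong) (use other in auto)
  also have "\<dots> = l (u k) * l (v k)" using k by simp
  also have "\<dots> = l (u k \<otimes> v k)"
  proof (cases "v k \<in> A")
    case True
    then show ?thesis using lin_charD(1)[OF l k(2)] by simp
  next
    case False
    then have "u k \<otimes> v k \<notin> A" using A_cancel[OF k(2)] uv by simp
    then show ?thesis using False lin_charD(3)[OF l] by simp
  qed
  also have "\<dots> = ind_rep l (g \<otimes> h) $$ (r, s)"
    using rs unfolding uv_eq by (simp add: ind_rep_def)
  finally show "ind_rep l (g \<otimes> h) $$ (r, s) = (ind_rep l g * ind_rep l h) $$ (r, s)" by simp
qed (auto simp: ind_rep_def)

lemma ind_rep_one:
  assumes l: "lin_char l"
  shows "ind_rep l \<one> = 1\<^sub>m q"
  unfolding ind_rep_def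
proof (rule eq_matI)
  fix i j assume "i < dim_row (1\<^sub>m q :: complex mat)" "j < dim_col (1\<^sub>m q :: complex mat)"
  then show "mat q q (\<lambda>(r, s). l (inv (x [^] r) \<otimes> \<one> \<otimes> x [^] s)) $$ (i, j) = 1\<^sub>m q $$ (i, j)"
    using ind_rep_A[OF l A_closed(2), of i j] lin_charD(2)[OF l] by (simp del: r_one)
qed auto

lemma ind_rep_hom:
  assumes l: "lin_char l"
  shows "ind_rep l \<in> hom G (GL_complex q)"
proof -
  have "ind_rep l g \<in> Units (ring_mat TYPE(complex) q ())" if g: "g \<in> carrier G" for g
  proof -
    have "ind_rep l g * ind_rep l (inv g) = 1\<^sub>m q" "ind_rep l (inv g) * ind_rep l g = 1\<^sub>m q"
      using ind_rep_mult[OF l, of g "inv g"] ind_rep_mult[OF l, of "inv g" g] g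
      by (simp_all add: ind_rep_one[OF l])
    then show ?thesis
      unfolding Units_def ring_mat_simps using ind_rep_carrier by blast
  qed
  then show ?thesis
    unfolding hom_def GL_complex_simps using ind_rep_mult[OF l] by auto
qed

definition ind_char :: "('a \<Rightarrow> complex) \<Rightarrow> 'a \<Rightarrow> complex" where
  "ind_char l = rep_character G (ind_rep l)"

lemma ind_char_eq: "g \<in> carrier G \<Longrightarrow> ind_char l g = (\<Sum>r<q. l (twist r g))"
  by (simp add: ind_char_def rep_character_def mat_trace_def ind_rep_def twist_def)

lemma ind_char_one: "lin_char l \<Longrightarrow> ind_char l \<one> = of_nat q"
  by (simp add: ind_char_eq lin_charD(2))

definition conj_char :: "('a \<Rightarrow> complex) \<Rightarrow> nat \<Rightarrow> 'a \<Rightarrow> complex" where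
  "conj_char l r g = (if g \<in> A then l (twist r g) else 0)"

lemma lin_char_conj: "lin_char l \<Longrightarrow> lin_char (conj_char l r)"
  by (auto simp: lin_char_def conj_char_def twist_mult)

lemma conj_char_0: "lin_char l \<Longrightarrow> conj_char l 0 = l"
  by (auto simp: lin_char_def conj_char_def fun_eq_iff)

lemma ind_char_A: "a \<in> A \<Longrightarrow> ind_char l a = (\<Sum>r<q. conj_char l r a)"
  by (simp add: ind_char_eq conj_char_def)

text \<open>The complement acts without fixed points on the nontrivial linear characters as well:
the map \<open>a \<mapsto> inv a \<otimes> twist j a\<close> with \<open>0 < j < q\<close> is
injective because the action on \<open>A\<close> has no fixed points, hence surjective by
finiteness, and a character that is invariant under the action is trivial on its image.\<close>
lemma conj_char_distinct:
  assumes l: "lin_char l" and nontriv: "\<exists>a\<in>A. l a \<noteq> 1" and rs: "r < s" "s < q"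
  shows "\<exists>a\<in>A. conj_char l r a \<noteq> conj_char l s a"
proof (rule ccontr)
  assume neg: "\<not> ?thesis"
  have eq: "l (twist r a) = l (twist s a)" if "a \<in> A" for a
  proof -
    have "conj_char l r a = conj_char l s a" using neg that by blast
    then show ?thesis using that by (simp add: conj_char_def)
  qed
  define j where "j = s - r"
  have j: "0 < j" "j < q" "s = r + j" using rs by (auto simp: j_def)
  have eqj: "l a = l (twist j a)" if a: "a \<in> A" for a
  proof -
    have "twist r (twist (q - r) a) = a" using a rs by (simp add: twist_twist twist_q)
    moreover have "twist s (twist (q - r) a) = twist j a"
    proof -
      have "twist s (twist (q - r) a) = twist (q + j) a" using a rs by (simp add: twist_twist j_def)
      also have "\<dots> = twist j (twist q a)" using a by (simp add: twist_twist)
      finally show ?thesis using a by (simp add: twist_q)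
    qed
    ultimately show ?thesis using eq[of "twist (q - r) a"] a by (metis A_carrier twist_A_iff)
  qed
  let ?f = "\<lambda>a. inv a \<otimes> twist j a"
  have "inj_on ?f A"
  proof (rule inj_onI)
    fix a b assume ab: "a \<in> A" "b \<in> A" "?f a = ?f b"
    let ?c = "b \<otimes> inv a"
    note c = A_carrier[OF ab(1)] A_carrier[OF ab(2)]
    have "twist j b = b \<otimes> (inv b \<otimes> twist j b)" using c by simp
    then have twist_b: "twist j b = b \<otimes> (inv a \<otimes> twist j a)" by (simp only: ab(3))
    have "twist j ?c = twist j b \<otimes> inv (twist j a)" using c by (simp add: twist_mult twist_inv)
    then have fixed: "twist j ?c = ?c" unfolding twist_b using c by (simp add: m_assoc)
    have "?c \<in> A" using ab(1,2) by simp
    then have "?c = \<one>" using j(1,2) fixed by (rule twist_fixed)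
    then have "inv (inv a) = b" using c by (intro inv_equality) simp_all
    then show "a = b" using c by simp
  qed
  moreover have "?f ` A \<subseteq> A" by (auto intro!: A_closed(1))
  ultimately have surj: "?f ` A = A" by (intro endo_inj_surj[OF finite_A])
  have "l b = 1" if "b \<in> A" for b
  proof -
    have "b \<in> ?f ` A" using that unfolding surj .
    then obtain a where a: "a \<in> A" "b = ?f a" by (elim imageE)
    have "twist j a \<in> A" using a(1) by simp
    then have "l b = l (inv a) * l (twist j a)"
      unfolding a(2) using a(1) by (intro lin_charD(1)[OF l]) simp_all
    also have "l (twist j a) = l a" by (rule eqj[OF a(1), symmetric])
    also have "l (inv a) * l a = 1" using lin_char_inv[OF l a(1)] by (simp only: mult.commute)
    finally show ?thesis .
  qed
  then show False using nontriv by blast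
qed

lemma ind_rep_A_vec:
  assumes l: "lin_char l" and a: "a \<in> A" and w: "w \<in> carrier_vec q" and i: "i < q"
  shows "(ind_rep l a *\<^sub>v w) $ i = conj_char l i a * w $ i"
proof -
  have "(ind_rep l a *\<^sub>v w) $ i = (\<Sum>s\<in>{0..<q}. l (inv (x [^] i) \<otimes> a \<otimes> x [^] s) * w $ s)"
    using i w by (simp add: ind_rep_def scalar_prod_def)
  also have "\<dots> = (\<Sum>s\<in>{0..<q}. if s = i then l (twist i a) * w $ i else 0)"
    by (rule sum.cong) (use ind_rep_A[OF l a i] in auto)
  also have "\<dots> = conj_char l i a * w $ i" using i a by (simp add: conj_char_def)
  finally show ?thesis .
qed

lemma ind_rep_unit_vec:
  assumes l: "lin_char l" and rs: "r < q" "s < q"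
  shows "ind_rep l (x [^] r \<otimes> inv (x [^] s)) *\<^sub>v unit_vec q s = unit_vec q r"
proof (rule eq_vecI)
  fix i assume "i < dim_vec (unit_vec q r :: complex vec)"
  then have i: "i < q" by simp
  have "(ind_rep l (x [^] r \<otimes> inv (x [^] s)) *\<^sub>v unit_vec q s) $ i
      = l (inv (x [^] i) \<otimes> (x [^] r \<otimes> inv (x [^] s)) \<otimes> x [^] s)"
    using i rs by (simp add: ind_rep_def)
  also have "inv (x [^] i) \<otimes> (x [^] r \<otimes> inv (x [^] s)) \<otimes> x [^] s = inv (x [^] i) \<otimes> \<one> \<otimes> x [^] r"
    by (simp add: m_assoc)
  also have "l \<dots> = unit_vec q r $ i"
    using ind_rep_A[OF l A_closed(2) i rs(1)] i rs lin_charD(2)[OF l] by (simp del: r_one)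
  finally show "(ind_rep l (x [^] r \<otimes> inv (x [^] s)) *\<^sub>v unit_vec q s) $ i = unit_vec q r $ i" .
qed (simp add: ind_rep_def)

text \<open>\<open>A\<close> acts diagonally through the \<open>q\<close> conjugates of
\<open>l\<close>, which are pairwise distinct. Given a vector of an invariant subspace with
nonzero \<open>s\<close>-th coordinate, the other coordinates can be annihilated one at a time:
subtract the appropriate multiple of the vector from its image under an element of
\<open>A\<close> that separates two conjugates. What remains is a multiple of a basis vector, and
the powers of \<open>x\<close> permute the basis vectors transitively.\<close>
lemma ind_rep_irreducible:
  assumes l: "lin_char l" and nontriv: "\<exists>a\<in>A. l a \<noteq> 1"
  shows "irreducible_rep G q (ind_rep l)"
  unfolding irreducible_rep_def
proof (intro conjI q_pos ind_rep_hom[OF l] allI impI)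
  fix W assume "VectorSpace.subspace class_ring W (module_vec TYPE(complex) q) \<and>
    (\<forall>g\<in>carrier G. \<forall>w\<in>W. ind_rep l g *\<^sub>v w \<in> W)"
  then have sub: "VectorSpace.subspace class_ring W (module_vec TYPE(complex) q)"
    and inv: "\<And>g w. g \<in> carrier G \<Longrightarrow> w \<in> W \<Longrightarrow> ind_rep l g *\<^sub>v w \<in> W" by auto
  note W = complex_subspaceD[OF sub]
  have Wc: "w \<in> W \<Longrightarrow> w \<in> carrier_vec q" for w using W(1) by blast
  show "W = {0\<^sub>v q} \<or> W = carrier_vec q"
  proof (cases "W = {0\<^sub>v q}")
    case False
    then obtain w where w: "w \<in> W" "w \<noteq> 0\<^sub>v q" using W(2) by blast
    obtain s where s: "s < q" "w $ s \<noteq> 0"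
      using eq_vecI[of w "0\<^sub>v q"] w(2) Wc[OF w(1)] by auto
    have "\<exists>w\<in>W. w $ s \<noteq> 0 \<and> (\<forall>r\<in>T. w $ r = 0)" if "finite T" "T \<subseteq> {..<q} - {s}" for T
      using that
    proof (induction T rule: finite_induct)
      case empty
      then show ?case using w s by blast
    next
      case (insert r T)
      then obtain w where w: "w \<in> W" "w $ s \<noteq> 0" "\<forall>r\<in>T. w $ r = 0" by auto
      have r: "r < q" "r \<noteq> s" using insert.prems by auto
      then obtain a where a: "a \<in> A" "conj_char l r a \<noteq> conj_char l s a"
        using conj_char_distinct[OF l nontriv, of r s] conj_char_distinct[OF l nontriv, of s r] s(1)
        by (metis linorder_neqE_nat)
      define w' where "w' = ind_rep l a *\<^sub>v w + (- conj_char l r a) \<cdot>\<^sub>v w"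
      have w': "w' \<in> W" unfolding w'_def using inv[of a w] a w by (intro W(3,4)) auto
      have entry: "w' $ i = (conj_char l i a - conj_char l r a) * w $ i" if "i < q" for i
        using ind_rep_A_vec[OF l a(1) Wc[OF w(1)] that] Wc[OF w(1)] that
        unfolding w'_def by (simp add: algebra_simps)
      show ?case
      proof (intro bexI[OF _ w'] conjI ballI)
        show "w' $ s \<noteq> 0" using entry[OF s(1)] a w by auto
        show "w' $ i = 0" if "i \<in> insert r T" for i
          using that entry[of i] w insert.prems by auto
      qed
    qed
    from this[of "{..<q} - {s}"] obtain w where w: "w \<in> W" "w $ s \<noteq> 0" "\<forall>r\<in>{..<q} - {s}. w $ r = 0"
      by auto
    have us_eq: "unit_vec q s = (1 / w $ s) \<cdot>\<^sub>v w"
    proof (rule eq_vecI)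
      fix i assume "i < dim_vec ((1 / w $ s) \<cdot>\<^sub>v w)"
      then have "i < q" using Wc[OF w(1)] by simp
      then show "unit_vec q s $ i = ((1 / w $ s) \<cdot>\<^sub>v w) $ i"
        using w(2,3) Wc[OF w(1)] s(1) by (cases "i = s") simp_all
    qed (use Wc[OF w(1)] in simp)
    have us: "unit_vec q s \<in> W" unfolding us_eq by (rule W(4)[OF w(1)])
    have ur: "unit_vec q r \<in> W" if "r < q" for r
      using inv[OF _ us, of "x [^] r \<otimes> inv (x [^] s)"] ind_rep_unit_vec[OF l that s(1)] by simp
    have "v \<in> W" if v: "v \<in> carrier_vec q" for v
    proof -
      have "vec q (\<lambda>i. if i < m then v $ i else 0) \<in> W" if "m \<le> q" for m
        using that
      proof (induction m)
        case 0
        have "vec q (\<lambda>i. if i < 0 then v $ i else 0) = 0\<^sub>v q" by (rule eq_vecI) auto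
        then show ?case using W(2) by simp
      next
        case (Suc m)
        have "vec q (\<lambda>i. if i < Suc m then v $ i else 0)
          = vec q (\<lambda>i. if i < m then v $ i else 0) + v $ m \<cdot>\<^sub>v unit_vec q m"
          using Suc.prems by (intro eq_vecI) (auto simp: less_Suc_eq)
        moreover have "\<dots> \<in> W" using Suc ur by (intro W(3,4)) auto
        ultimately show ?case by simp
      qed
      from this[of q] have "vec q (\<lambda>i. if i < q then v $ i else 0) \<in> W" by simp
      also have "vec q (\<lambda>i. if i < q then v $ i else 0) = v" using v by (intro eq_vecI) auto
      finally show ?thesis .
    qed
    then have "W = carrier_vec q" using Wc by (intro equalityI subsetI)
    then show ?thesis ..
  next
    case True
    then show ?thesis ..
  qed
qed

text \<open>The intersection of the kernels of all conjugates of \<open>l\<close>, that is, the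
largest normal subgroup of \<open>G\<close> contained in the kernel of \<open>l\<close> on
\<open>A\<close>.\<close>
definition core :: "('a \<Rightarrow> complex) \<Rightarrow> 'a set" where
  "core l = {a \<in> A. \<forall>r<q. l (twist r a) = 1}"

lemma subgroup_core:
  assumes l: "lin_char l"
  shows "subgroup (core l) G"
proof (rule subgroupI)
  have "\<one> \<in> core l" using lin_charD(2)[OF l] by (simp add: core_def)
  then show "core l \<noteq> {}" by blast
  fix a assume a: "a \<in> core l"
  show "inv a \<in> core l"
    unfolding core_def
  proof (safe)
    show "inv a \<in> A" using a by (simp add: core_def)
    fix r assume "r < q"
    then show "l (twist r (inv a)) = 1"
      using a lin_char_inv[OF l, of "twist r a"] by (simp add: core_def twist_inv)
  qed
qed (auto simp: core_def twist_mult lin_charD(1)[OF l])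

text \<open>The character value is a sum of \<open>q\<close> complex numbers of modulus at most
\<open>1\<close>; it equals \<open>q\<close> only if each of them is \<open>1\<close>. Outside
\<open>A\<close> the summands vanish.\<close>
lemma char_kernel_ind_char:
  assumes l: "lin_char l"
  shows "char_kernel G (ind_char l) = core l"
proof (intro equalityI subsetI)
  fix g assume "g \<in> char_kernel G (ind_char l)"
  then have g: "g \<in> carrier G" "(\<Sum>r<q. l (twist r g)) = of_nat q"
    using ind_char_eq[of g l] ind_char_one[OF l] by (auto simp: char_kernel_def)
  have le: "Re (l y) \<le> 1" for y
    using complex_Re_le_cmod[of "l y"] lin_char_norm_le[OF l, of y] by linarith
  have "(\<Sum>r<q. 1 - Re (l (twist r g))) = 0"
    using arg_cong[OF g(2), of Re] by (simp add: sum_subtractf)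
  then have Re: "Re (l (twist r g)) = 1" if "r < q" for r
    using sum_nonneg_eq_0_iff[of "{..<q}" "\<lambda>r. 1 - Re (l (twist r g))"] le that by auto
  have one: "l (twist r g) = 1" if "r < q" for r
  proof -
    have "cmod (l (twist r g)) ^ 2 \<le> 1" using lin_char_norm_le[OF l] by (simp add: power_le_one)
    then have "Im (l (twist r g)) = 0" using Re[OF that] by (simp add: cmod_power2)
    then show ?thesis using Re[OF that] by (simp add: complex_eq_iff)
  qed
  have "g \<in> A"
  proof (rule ccontr)
    assume "g \<notin> A"
    then show False using one[OF q_pos] lin_charD(3)[OF l] g(1) by simp
  qed
  then show "g \<in> core l" using one by (simp add: core_def)
next
  fix g assume "g \<in> core l"
  then show "g \<in> char_kernel G (ind_char l)"
    using ind_char_one[OF l] by (simp add: char_kernel_def core_def ind_char_eq)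
qed

lemma codegree_ind_char:
  assumes l: "lin_char l"
  shows "codegree G (ind_char l) = real (card A) / real (card (core l))"
proof -
  have "card (rcosets (core l)) * card (core l) = q * card A"
    using lagrange[OF subgroup_core[OF l]] order_G by simp
  moreover have "card (core l) > 0"
    using subgroup.finite_imp_card_positive[OF subgroup_core[OF l] fin] .
  ultimately have "real (card (rcosets (core l))) = real q * real (card A) / real (card (core l))"
    by (metis eq_divide_eq less_irrefl of_nat_eq_0_iff of_nat_mult)
  then show ?thesis
    using q_pos unfolding codegree_def char_kernel_ind_char[OF l] ind_char_one[OF l] by simp
qed

lemma lin_char_orthogonal:
  assumes l: "lin_char l" and m: "lin_char m"
  shows "(\<Sum>a\<in>A. l a * m (inv a)) = (if l = m then of_nat (card A) else 0)"
proof (cases "l = m")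
  case True
  then show ?thesis using lin_char_inv[OF m] by simp
next
  case False
  then obtain b where b: "b \<in> A" "l b \<noteq> m b"
    using lin_charD(3)[OF l] lin_charD(3)[OF m] by (metis ext)
  let ?S = "\<Sum>a\<in>A. l a * m (inv a)"
  have bij: "bij_betw (\<lambda>a. b \<otimes> a) A A"
    using b(1) by (intro bij_betwI[where g = "\<lambda>a. inv b \<otimes> a"]) auto
  have "?S = (\<Sum>a\<in>A. l (b \<otimes> a) * m (inv (b \<otimes> a)))"
    using sum.reindex_bij_betw[OF bij, of "\<lambda>a. l a * m (inv a)"] by simp
  also have "\<dots> = (\<Sum>a\<in>A. l b * m (inv b) * (l a * m (inv a)))"
    using b(1) by (intro sum.cong) (auto simp: inv_mult_group lin_charD(1)[OF l] lin_charD(1)[OF m])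
  also have "\<dots> = l b * m (inv b) * ?S" by (simp add: sum_distrib_left)
  finally have "(l b * m (inv b) - 1) * ?S = 0" by (simp add: algebra_simps)
  moreover have "l b * m (inv b) \<noteq> 1"
    using lin_char_inv[OF m b(1)] b(2) by (metis mult_cancel_right mult_zero_right zero_neq_one)
  ultimately show ?thesis using False by auto
qed

text \<open>Restricted to \<open>A\<close>, the induced character is the sum of the conjugates of
\<open>l\<close>, so taking the inner product with \<open>m\<close> detects whether
\<open>m\<close> is one of them.\<close>
lemma ind_char_eq_imp_conj:
  assumes l: "lin_char l" and m: "lin_char m" and eq: "ind_char l = ind_char m"
  shows "m \<in> conj_char l ` {..<q}"
proof (rule ccontr)
  assume neg: "m \<notin> conj_char l ` {..<q}"
  have expand: "(\<Sum>a\<in>A. ind_char k a * m (inv a)) = (\<Sum>r<q. if conj_char k r = m then of_nat (card A) else 0)"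
    if k: "lin_char k" for k
  proof -
    have "(\<Sum>a\<in>A. ind_char k a * m (inv a)) = (\<Sum>a\<in>A. \<Sum>r<q. conj_char k r a * m (inv a))"
      by (rule sum.cong) (auto simp: ind_char_A sum_distrib_right)
    also have "\<dots> = (\<Sum>r<q. \<Sum>a\<in>A. conj_char k r a * m (inv a))" by (rule sum.swap)
    also have "\<dots> = (\<Sum>r<q. if conj_char k r = m then of_nat (card A) else 0)"
      using lin_char_orthogonal[OF lin_char_conj[OF k] m] by simp
    finally show ?thesis .
  qed
  have "(\<Sum>r<q. if conj_char l r = m then of_nat (card A) else 0 :: complex) = 0"
    by (rule sum.neutral) (use neg in auto)
  then have "of_nat (\<Sum>r<q. if conj_char m r = m then card A else 0) = (0 :: complex)"
    using expand[OF l] expand[OF m] eq by (simp add: if_distrib cong: if_cong)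
  then have "(\<Sum>r<q. if conj_char m r = m then card A else 0) = 0" by (simp only: of_nat_eq_0_iff)
  then have "card A = 0" using q_pos conj_char_0[OF m] by (auto split: if_splits)
  then show False using finite_A A_closed(2) by auto
qed

text \<open>At most \<open>q\<close> linear characters of \<open>A\<close> induce the same
irreducible character of \<open>G\<close>, so every codegree is counted at most \<open>q\<close>
times on the left.\<close>
theorem sum_codegrees_ge:
  assumes L: "finite L" "\<And>l. l \<in> L \<Longrightarrow> lin_char l" "\<And>l. l \<in> L \<Longrightarrow> \<exists>a\<in>A. l a \<noteq> 1"
  shows "(\<Sum>l\<in>L. real (card A) / real (card (core l))) \<le> real q * sum_codegrees G"
proof -
  have irr: "ind_char ` L \<subseteq> Irr G"
    using ind_rep_irreducible[OF L(2,3)] unfolding Irr_def ind_char_def by blast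
  have "(\<Sum>l\<in>L. real (card A) / real (card (core l))) = (\<Sum>l\<in>L. codegree G (ind_char l))"
    by (rule sum.cong) (simp_all add: codegree_ind_char L(2))
  also have "\<dots> = (\<Sum>\<psi>\<in>ind_char ` L. \<Sum>l\<in>{l\<in>L. ind_char l = \<psi>}. codegree G (ind_char l))"
    by (rule sum.group[symmetric]) (use L(1) in auto)
  also have "\<dots> = (\<Sum>\<psi>\<in>ind_char ` L. real (card {l\<in>L. ind_char l = \<psi>}) * codegree G \<psi>)"
    by (rule sum.cong) auto
  also have "\<dots> \<le> (\<Sum>\<psi>\<in>ind_char ` L. real q * codegree G \<psi>)"
  proof (intro sum_mono mult_right_mono)
    fix \<psi> assume chi: "\<psi> \<in> ind_char ` L"
    then obtain l where l: "l \<in> L" "\<psi> = ind_char l" by blast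
    have "{m\<in>L. ind_char m = \<psi>} \<subseteq> conj_char l ` {..<q}"
      using ind_char_eq_imp_conj[OF L(2)[OF l(1)] L(2)] l(2) by auto
    then have "card {m\<in>L. ind_char m = \<psi>} \<le> card (conj_char l ` {..<q})" by (intro card_mono) auto
    also have "\<dots> \<le> q" using card_image_le[of "{..<q}" "conj_char l"] by simp
    finally show "real (card {l\<in>L. ind_char l = \<psi>}) \<le> real q" by simp
    show "0 \<le> codegree G \<psi>" using codegree_nonneg[OF is_group] irr chi by blast
  qed
  also have "\<dots> \<le> (\<Sum>\<psi>\<in>Irr G. real q * codegree G \<psi>)"
    using finite_Irr[OF is_group fin] irr codegree_nonneg[OF is_group]
    by (intro sum_mono2) auto
  also have "\<dots> = real q * sum_codegrees G" by (simp add: sum_codegrees_def sum_distrib_left)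
  finally show ?thesis .
qed

end

section \<open>Kernels that are a product of planes over prime fields\<close>

text \<open>All orbits of \<open>f\<close> have exactly three elements.\<close>
lemma three_dvd_card_of_fixed_point_free_3_cycle:
  assumes "finite S" "\<And>s. s \<in> S \<Longrightarrow> f s \<in> S" "\<And>s. s \<in> S \<Longrightarrow> f (f (f s)) = s" "\<And>s. s \<in> S \<Longrightarrow> f s \<noteq> s"
  shows "3 dvd card S"
  using assms
proof (induction S rule: finite_psubset_induct)
  case (psubset S)
  show ?case
  proof (cases "S = {}")
    case False
    then obtain s where s: "s \<in> S" by blast
    note f = psubset.prems
    let ?O = "{s, f s, f (f s)}"
    have O: "?O \<subseteq> S" using f(1) s by simp
    have "f s \<noteq> s" "f (f s) \<noteq> f s" using f(3)[OF s] f(3)[OF f(1)[OF s]] .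
    moreover have "f (f s) \<noteq> s"
    proof
      assume "f (f s) = s"
      then have "f (f (f s)) = f s" by (rule arg_cong)
      then show False using f(2)[OF s] f(3)[OF s] by simp
    qed
    ultimately have "card ?O = 3" by (auto simp: card_insert_if)
    have "3 dvd card (S - ?O)"
    proof (rule psubset.IH)
      show "S - ?O \<subset> S" using s by blast
      fix u assume u: "u \<in> S - ?O"
      show "f (f (f u)) = u" "f u \<noteq> u" using f(2,3) u by simp_all
      have u3: "f (f (f u)) = u" "f (f (f s)) = s" using f(2) u s by simp_all
      have "f u \<noteq> s" "f u \<noteq> f s" "f u \<noteq> f (f s)"
      proof -
        show "f u \<noteq> s" using u u3 by auto
        show "f u \<noteq> f s"
        proof
          assume "f u = f s"
          then have "f (f (f u)) = f (f (f s))" by simp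
          then show False using u u3 by simp
        qed
        show "f u \<noteq> f (f s)"
        proof
          assume "f u = f (f s)"
          then have "f (f (f u)) = f (f (f (f s)))" by simp
          then show False using u u3 by simp
        qed
      qed
      then show "f u \<in> S - ?O" using f(1) u by simp
    qed
    moreover have "card S = card (S - ?O) + card ?O"
      using card_Diff_subset[of ?O S] card_mono[OF psubset.hyps O] O by simp
    ultimately show ?thesis using \<open>card ?O = 3\<close> by simp
  qed simp
qed

text \<open>The standard additive character of the integers modulo \<open>m\<close>.\<close>
definition unit_root :: "nat \<Rightarrow> int \<Rightarrow> complex" where
  "unit_root m z = cis (2 * pi * of_int z / real m)"

lemma unit_root_add: "unit_root m (z + w) = unit_root m z * unit_root m w"
  by (simp add: unit_root_def cis_mult add_divide_distrib ring_distribs)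

lemma unit_root_eq_1_iff:
  assumes "m > 0"
  shows "unit_root m z = 1 \<longleftrightarrow> int m dvd z"
proof
  assume "unit_root m z = 1"
  then have "cos (2 * pi * of_int z / real m) = 1" by (simp add: unit_root_def complex_eq_iff)
  then obtain k :: int where "2 * pi * of_int z / real m = of_int k * 2 * pi"
    unfolding cos_one_2pi_int by blast
  then have "real_of_int z = real_of_int (int m * k)" using assms by (simp add: field_simps)
  then have "z = int m * k" by (simp only: of_int_eq_iff)
  then show "int m dvd z" by simp
next
  assume "int m dvd z"
  then obtain k where "z = int m * k" by blast
  then have "unit_root m z = cis (2 * pi * of_int k)" using assms by (simp add: unit_root_def field_simps)
  then show "unit_root m z = 1" by simp
qed

lemma unit_root_0 [simp]: "unit_root m 0 = 1"
  by (simp add: unit_root_def)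

lemma unit_root_nonzero: "unit_root m z \<noteq> 0"
  by (simp add: unit_root_def)

lemma unit_root_cong:
  assumes m: "m > 0"
  shows "unit_root m z = unit_root m w \<longleftrightarrow> int m dvd z - w"
proof -
  have "unit_root m z = unit_root m (z - w) * unit_root m w"
    using unit_root_add[of m "z - w" w] by simp
  then show ?thesis using unit_root_eq_1_iff[OF m, of "z - w"] unit_root_nonzero[of m w] by simp
qed

lemma (in frobenius_cyclic_complement) core_twist:
  assumes "a \<in> core l"
  shows "twist 1 a \<in> core l"
proof -
  have a: "a \<in> A" "\<And>r. r < q \<Longrightarrow> l (twist r a) = 1" using assms by (auto simp: core_def)
  have "l (twist r (twist 1 a)) = 1" if "r < q" for r
  proof (cases "Suc r = q")
    case True
    then have "twist r (twist 1 a) = twist 0 a" using a(1) by (simp add: twist_twist twist_q)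
    then show ?thesis using a(2)[OF q_pos] by simp
  next
    case False
    then show ?thesis using a that by (simp add: twist_twist)
  qed
  then show ?thesis using a(1) by (simp add: core_def)
qed

text \<open>Here the kernel is the product of the groups \<open>C\<^sub>p \<times>
C\<^sub>p\<close> for the distinct primes \<open>p = pr i\<close>, all congruent to
\<open>2\<close> modulo \<open>3\<close>. The isomorphism is recorded as a coordinate map
\<open>\<phi>\<close>, with coordinates represented by residues.\<close>
locale frobenius_rank_two = frobenius_cyclic_complement G A x 3 for G (structure) and A x +
  fixes t :: nat and pr :: "nat \<Rightarrow> nat" and \<phi> :: "'a \<Rightarrow> nat \<Rightarrow> int \<times> int"
  assumes pr: "i < t \<Longrightarrow> prime (pr i)" "i < t \<Longrightarrow> pr i mod 3 = 2" "inj_on pr {..<t}"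
    and phi_bij: "bij_betw \<phi> A (\<Pi>\<^sub>E i\<in>{..<t}. {0..<int (pr i)} \<times> {0..<int (pr i)})"
    and phi_fst: "a \<in> A \<Longrightarrow> b \<in> A \<Longrightarrow> i < t \<Longrightarrow> fst (\<phi> (a \<otimes> b) i) = (fst (\<phi> a i) + fst (\<phi> b i)) mod int (pr i)"
    and phi_snd: "a \<in> A \<Longrightarrow> b \<in> A \<Longrightarrow> i < t \<Longrightarrow> snd (\<phi> (a \<otimes> b) i) = (snd (\<phi> a i) + snd (\<phi> b i)) mod int (pr i)"
begin

abbreviation box :: "nat \<Rightarrow> (int \<times> int) set" where
  "box i \<equiv> {0..<int (pr i)} \<times> {0..<int (pr i)}"

definition coords :: "(nat \<Rightarrow> int \<times> int) set" where
  "coords = (\<Pi>\<^sub>E i\<in>{..<t}. box i)"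

lemma pr_pos: "i < t \<Longrightarrow> pr i > 0"
  using pr(1) prime_gt_0_nat by blast

lemma pr_gt_1: "i < t \<Longrightarrow> pr i > 1"
  using pr(1) prime_gt_1_nat by blast

lemma coords_range:
  assumes "v \<in> coords" "i < t"
  shows "0 \<le> fst (v i)" "fst (v i) < int (pr i)" "0 \<le> snd (v i)" "snd (v i) < int (pr i)"
proof -
  have "v i \<in> box i" using assms unfolding coords_def by (auto dest: PiE_mem)
  then show "0 \<le> fst (v i)" "fst (v i) < int (pr i)" "0 \<le> snd (v i)" "snd (v i) < int (pr i)"
    by (auto simp: mem_Times_iff)
qed

lemma coords_eqI: "v \<in> coords \<Longrightarrow> w \<in> coords \<Longrightarrow> (\<And>i. i < t \<Longrightarrow> v i = w i) \<Longrightarrow> v = w"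
  unfolding coords_def by (rule PiE_ext) auto

lemma phi_coords: "a \<in> A \<Longrightarrow> \<phi> a \<in> coords"
  using phi_bij unfolding coords_def bij_betw_def by blast

lemma phi_inj: "a \<in> A \<Longrightarrow> b \<in> A \<Longrightarrow> \<phi> a = \<phi> b \<Longrightarrow> a = b"
  using phi_bij unfolding bij_betw_def inj_on_def by blast

lemma phi_surj:
  assumes "v \<in> coords" obtains a where "a \<in> A" "\<phi> a = v"
  using assms phi_bij unfolding coords_def bij_betw_def by (metis imageE)

lemma card_A: "card A = (\<Prod>i<t. (pr i)^2)"
  using bij_betw_same_card[OF phi_bij] by (simp add: card_PiE card_cartesian_product power2_eq_square)

lemma phi_one: "i < t \<Longrightarrow> \<phi> \<one> i = (0, 0)"
proof -
  assume i: "i < t"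
  note r = coords_range[OF phi_coords[OF A_closed(2)] i]
  have z: "z = 0" if "0 \<le> z" "z < m" "z = (z + z) mod m" for z m :: int
  proof -
    have "z mod m = z" using that(1,2) by simp
    then have "(z + z) mod m = z mod m" using that(3) by simp
    then have "m dvd (z + z) - z" by (simp only: mod_eq_dvd_iff)
    then have "m dvd z" by simp
    then show ?thesis using that(1,2) zdvd_not_zless[of z m] by (cases "z = 0") auto
  qed
  have "fst (\<phi> \<one> i) = 0" using z[OF r(1,2)] phi_fst[of \<one> \<one> i] i by simp
  moreover have "snd (\<phi> \<one> i) = 0" using z[OF r(3,4)] phi_snd[of \<one> \<one> i] i by simp
  ultimately show ?thesis by (simp add: prod_eq_iff)
qed

lemma A_eq_one:
  assumes "a \<in> A" "\<And>i. i < t \<Longrightarrow> \<phi> a i = (0, 0)"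
  shows "a = \<one>"
proof (rule phi_inj[OF assms(1) A_closed(2)])
  show "\<phi> a = \<phi> \<one>"
    by (rule coords_eqI[OF phi_coords[OF assms(1)] phi_coords[OF A_closed(2)]]) (simp add: assms(2) phi_one)
qed

lemma pow_A: "a \<in> A \<Longrightarrow> a [^] (n::nat) \<in> A"
  by (induction n) auto

lemma phi_pow:
  assumes a: "a \<in> A" and i: "i < t"
  shows "fst (\<phi> (a [^] n) i) = (int n * fst (\<phi> a i)) mod int (pr i)"
    "snd (\<phi> (a [^] n) i) = (int n * snd (\<phi> a i)) mod int (pr i)"
proof -
  have step: "(int k * z mod m + z) mod m = int (Suc k) * z mod m" for k and z m :: int
  proof -
    have "(int k * z mod m + z) mod m = (int k * z + z) mod m" by (rule mod_add_left_eq)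
    also have "int k * z + z = int (Suc k) * z" by (simp add: distrib_right)
    finally show ?thesis .
  qed
  show "fst (\<phi> (a [^] n) i) = (int n * fst (\<phi> a i)) mod int (pr i)"
  proof (induction n)
    case (Suc n)
    then show ?case unfolding step[symmetric] using a i by (simp add: phi_fst pow_A)
  qed (use i phi_one in simp)
  show "snd (\<phi> (a [^] n) i) = (int n * snd (\<phi> a i)) mod int (pr i)"
  proof (induction n)
    case (Suc n)
    then show ?case unfolding step[symmetric] using a i by (simp add: phi_snd pow_A)
  qed (use i phi_one in simp)
qed

lemma phi_pow_eq_0_iff:
  assumes "a \<in> A" "i < t"
  shows "\<phi> (a [^] n) i = (0, 0) \<longleftrightarrow> pr i dvd n \<or> \<phi> a i = (0, 0)"
proof -
  note r = coords_range[OF phi_coords[OF assms(1)] assms(2)]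
  have P: "prime (int (pr i))" using pr(1)[OF assms(2)] by simp
  have z: "(int n * z) mod int (pr i) = 0 \<longleftrightarrow> pr i dvd n \<or> z = 0"
    if "0 \<le> z" "z < int (pr i)" for z
  proof -
    have "int (pr i) dvd z \<longleftrightarrow> z = 0"
      using that zdvd_not_zless[of z "int (pr i)"] by (cases "z = 0") auto
    then show ?thesis
      unfolding mod_eq_0_iff_dvd prime_dvd_mult_iff[OF P] by (simp only: of_nat_dvd_iff)
  qed
  show ?thesis
    unfolding prod_eq_iff phi_pow[OF assms] fst_conv snd_conv z[OF r(1,2)] z[OF r(3,4)] by blast
qed

text \<open>The Sylow subgroup for the prime \<open>pr i\<close>. It consists of the elements
annihilated by \<open>pr i\<close>, and is therefore invariant under conjugation.\<close>
definition axis :: "nat \<Rightarrow> 'a set" where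
  "axis i = {a \<in> A. \<forall>j<t. j \<noteq> i \<longrightarrow> \<phi> a j = (0, 0)}"

lemma axis_iff_pow:
  assumes a: "a \<in> A" and i: "i < t"
  shows "a \<in> axis i \<longleftrightarrow> a [^] pr i = \<one>"
proof -
  have "a [^] pr i = \<one> \<longleftrightarrow> (\<forall>j<t. \<phi> (a [^] pr i) j = (0, 0))"
    using A_eq_one[OF pow_A[OF a]] phi_one by auto
  also have "\<dots> \<longleftrightarrow> (\<forall>j<t. pr j dvd pr i \<or> \<phi> a j = (0, 0))"
    using phi_pow_eq_0_iff[OF a] by blast
  also have "\<dots> \<longleftrightarrow> (\<forall>j<t. j \<noteq> i \<longrightarrow> \<phi> a j = (0, 0))"
  proof -
    have "pr j dvd pr i \<longleftrightarrow> j = i" if "j < t" for j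
      using primes_dvd_imp_eq[OF pr(1)[OF that] pr(1)[OF i]] inj_onD[OF pr(3), of j i] that i by auto
    then show ?thesis by blast
  qed
  finally show ?thesis using a by (simp add: axis_def)
qed

lemma twist_pow: "a \<in> A \<Longrightarrow> twist r (a [^] (n::nat)) = twist r a [^] n"
  by (induction n) (simp_all add: twist_mult pow_A)

lemma twist_axis:
  assumes "a \<in> axis i" "i < t"
  shows "twist r a \<in> axis i"
proof -
  have a: "a \<in> A" using assms by (simp add: axis_def)
  then have "twist r a [^] pr i = twist r (a [^] pr i)" by (simp add: twist_pow)
  also have "\<dots> = \<one>" using axis_iff_pow[OF a assms(2)] assms(1) by simp
  finally show ?thesis using axis_iff_pow[of "twist r a" i] a assms(2) by simp
qed

lemma subgroup_axis:
  assumes i: "i < t"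
  shows "subgroup (axis i) G"
proof (rule subgroupI)
  show "axis i \<subseteq> carrier G" by (auto simp: axis_def)
  have "\<one> \<in> axis i" using phi_one by (simp add: axis_def)
  then show "axis i \<noteq> {}" by blast
next
  fix a b assume "a \<in> axis i" "b \<in> axis i"
  then show "a \<otimes> b \<in> axis i" by (auto simp: axis_def prod_eq_iff phi_fst phi_snd)
next
  fix a assume a: "a \<in> axis i"
  then have aA: "a \<in> A" by (simp add: axis_def)
  then have "inv a [^] pr i = \<one>" using axis_iff_pow[OF aA i] a by (simp add: nat_pow_inv)
  then show "inv a \<in> axis i" using axis_iff_pow[of "inv a" i] aA i by simp
qed

definition single :: "nat \<Rightarrow> int \<times> int \<Rightarrow> nat \<Rightarrow> int \<times> int" where
  "single i b = (\<lambda>j\<in>{..<t}. if j = i then b else (0, 0))"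

lemma single_coords: "i < t \<Longrightarrow> b \<in> box i \<Longrightarrow> single i b \<in> coords"
  unfolding single_def coords_def using pr_pos by auto

lemma card_axis:
  assumes i: "i < t"
  shows "card (axis i) = (pr i)^2"
proof -
  have "bij_betw (\<lambda>a. \<phi> a i) (axis i) (box i)"
  proof (rule bij_betw_imageI)
    show "inj_on (\<lambda>a. \<phi> a i) (axis i)"
    proof (rule inj_onI)
      fix a b assume ab: "a \<in> axis i" "b \<in> axis i" "\<phi> a i = \<phi> b i"
      then have AA: "a \<in> A" "b \<in> A" by (auto simp: axis_def)
      have "\<phi> a j = \<phi> b j" if "j < t" for j
        using ab that by (cases "j = i") (auto simp: axis_def)
      then have "\<phi> a = \<phi> b" by (intro coords_eqI[OF phi_coords[OF AA(1)] phi_coords[OF AA(2)]])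
      then show "a = b" by (rule phi_inj[OF AA])
    qed
    show "(\<lambda>a. \<phi> a i) ` axis i = box i"
    proof (intro equalityI subsetI)
      fix b assume "b \<in> (\<lambda>a. \<phi> a i) ` axis i"
      then obtain a where a: "a \<in> A" "b = \<phi> a i" by (auto simp: axis_def)
      show "b \<in> box i" using coords_range[OF phi_coords[OF a(1)] i] unfolding a(2) by (simp add: mem_Times_iff)
    next
      fix b assume b: "b \<in> box i"
      obtain a where a: "a \<in> A" "\<phi> a = single i b" using phi_surj[OF single_coords[OF i b]] .
      then have "a \<in> axis i" "\<phi> a i = b" using i by (auto simp: axis_def single_def)
      then show "b \<in> (\<lambda>a. \<phi> a i) ` axis i" by (intro image_eqI[of _ _ a]) simp_all
    qed
  qed
  from bij_betw_same_card[OF this] show ?thesis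
    by (simp add: card_cartesian_product power2_eq_square)
qed

text \<open>The linear character of the kernel with coordinate vector \<open>v\<close>, under the
standard pairing.\<close>
definition dual :: "(nat \<Rightarrow> int \<times> int) \<Rightarrow> 'a \<Rightarrow> complex" where
  "dual v a = (if a \<in> A then \<Prod>i<t. unit_root (pr i) (fst (v i) * fst (\<phi> a i) + snd (v i) * snd (\<phi> a i)) else 0)"

lemma lin_char_dual: "lin_char (dual v)"
  unfolding lin_char_def
proof (intro conjI ballI allI impI)
  fix a b assume ab: "a \<in> A" "b \<in> A"
  have "unit_root (pr i) (fst (v i) * fst (\<phi> (a \<otimes> b) i) + snd (v i) * snd (\<phi> (a \<otimes> b) i)) =
     unit_root (pr i) (fst (v i) * fst (\<phi> a i) + snd (v i) * snd (\<phi> a i)) *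
     unit_root (pr i) (fst (v i) * fst (\<phi> b i) + snd (v i) * snd (\<phi> b i))" if i: "i < t" for i
  proof -
    let ?m = "int (pr i)"
    have "[fst (v i) * ((fst (\<phi> a i) + fst (\<phi> b i)) mod ?m) + snd (v i) * ((snd (\<phi> a i) + snd (\<phi> b i)) mod ?m)
      = fst (v i) * (fst (\<phi> a i) + fst (\<phi> b i)) + snd (v i) * (snd (\<phi> a i) + snd (\<phi> b i))] (mod ?m)"
      by (intro cong_add cong_mult cong_refl cong_mod_left[THEN iffD2])
    then have "?m dvd (fst (v i) * fst (\<phi> (a \<otimes> b) i) + snd (v i) * snd (\<phi> (a \<otimes> b) i)) -
       (fst (v i) * (fst (\<phi> a i) + fst (\<phi> b i)) + snd (v i) * (snd (\<phi> a i) + snd (\<phi> b i)))"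
      unfolding phi_fst[OF ab i] phi_snd[OF ab i] cong_iff_dvd_diff .
    then have "unit_root (pr i) (fst (v i) * fst (\<phi> (a \<otimes> b) i) + snd (v i) * snd (\<phi> (a \<otimes> b) i)) =
      unit_root (pr i) (fst (v i) * (fst (\<phi> a i) + fst (\<phi> b i)) + snd (v i) * (snd (\<phi> a i) + snd (\<phi> b i)))"
      using unit_root_cong[OF pr_pos[OF i]] by blast
    also have "\<dots> = unit_root (pr i) ((fst (v i) * fst (\<phi> a i) + snd (v i) * snd (\<phi> a i)) +
      (fst (v i) * fst (\<phi> b i) + snd (v i) * snd (\<phi> b i)))"
      by (simp add: algebra_simps)
    finally show ?thesis unfolding unit_root_add .
  qed
  then show "dual v (a \<otimes> b) = dual v a * dual v b"
    using ab A_closed(1)[OF ab] unfolding dual_def prod.distrib[symmetric] if_P[OF ab(1)] if_P[OF ab(2)]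
    by simp
next
  show "dual v \<one> = 1" by (simp add: dual_def phi_one)
qed (simp add: dual_def)

lemma dual_single:
  assumes i: "i < t" and a: "a \<in> A" "\<phi> a = single i (c, d)"
  shows "dual v a = unit_root (pr i) (fst (v i) * c + snd (v i) * d)"
proof -
  have "dual v a = (\<Prod>j<t. unit_root (pr j) (fst (v j) * fst (\<phi> a j) + snd (v j) * snd (\<phi> a j)))"
    using a(1) by (simp add: dual_def)
  also have "\<dots> = (\<Prod>j<t. if j = i then unit_root (pr i) (fst (v i) * c + snd (v i) * d) else 1)"
    by (rule prod.cong) (auto simp: a(2) single_def)
  finally show ?thesis using i by simp
qed

text \<open>The \<open>i\<close>-th coordinate of \<open>v\<close> can be read off from the values
of the character on the elements with coordinates \<open>(1, 0)\<close> and \<open>(0, 1)\<close>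
on the \<open>i\<close>-th axis.\<close>
lemma dual_coordinate:
  assumes v: "v \<in> coords" and w: "w \<in> coords" and i: "i < t" and eq: "\<And>a. a \<in> axis i \<Longrightarrow> dual v a = dual w a"
  shows "v i = w i"
proof -
  have gt: "int (pr i) > 1" using pr_gt_1[OF i] by simp
  have z: "z = y" if "0 \<le> z" "z < m" "0 \<le> y" "y < m" "m dvd z - y" for z y m :: int
  proof -
    have "z mod m = y mod m" using that(5) by (simp only: mod_eq_dvd_iff)
    then show ?thesis using that(1-4) by simp
  qed
  have ax: "\<exists>a\<in>axis i. \<phi> a = single i b" if b: "b \<in> box i" for b
  proof -
    obtain a where a: "a \<in> A" "\<phi> a = single i b" using phi_surj[OF single_coords[OF i b]] .
    then have "a \<in> axis i" by (auto simp: axis_def single_def)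
    then show ?thesis using a by blast
  qed
  obtain a where a: "a \<in> axis i" "\<phi> a = single i (1, 0)" using ax[of "(1,0)"] gt by auto
  obtain b where b: "b \<in> axis i" "\<phi> b = single i (0, 1)" using ax[of "(0,1)"] gt by auto
  have A: "a \<in> A" "b \<in> A" using a b by (auto simp: axis_def)
  have "unit_root (pr i) (fst (v i)) = unit_root (pr i) (fst (w i))"
    using eq[OF a(1)] dual_single[OF i A(1) a(2)] by simp
  then have "fst (v i) = fst (w i)"
    unfolding unit_root_cong[OF pr_pos[OF i]] by (rule z[OF coords_range(1,2)[OF v i] coords_range(1,2)[OF w i]])
  moreover have "unit_root (pr i) (snd (v i)) = unit_root (pr i) (snd (w i))"
    using eq[OF b(1)] dual_single[OF i A(2) b(2)] by simp
  then have "snd (v i) = snd (w i)"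
    unfolding unit_root_cong[OF pr_pos[OF i]] by (rule z[OF coords_range(3,4)[OF v i] coords_range(3,4)[OF w i]])
  ultimately show ?thesis by (simp add: prod_eq_iff)
qed

definition origin :: "nat \<Rightarrow> int \<times> int" where
  "origin = (\<lambda>i\<in>{..<t}. (0, 0))"

lemma origin_coords: "origin \<in> coords"
  unfolding origin_def coords_def using pr_pos by auto

lemma dual_origin: "a \<in> A \<Longrightarrow> dual origin a = 1"
  by (simp add: dual_def origin_def)

lemma inj_on_dual: "inj_on dual coords"
proof (rule inj_onI)
  fix v w assume vw: "v \<in> coords" "w \<in> coords" "dual v = dual w"
  show "v = w"
    by (rule coords_eqI[OF vw(1,2)], rule dual_coordinate[OF vw(1,2)]) (simp_all add: vw(3))
qed

text \<open>The complement acts irreducibly on \<open>C\<^sub>p \<times> C\<^sub>p\<close>. An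
invariant subgroup has order \<open>1\<close>, \<open>p\<close> or \<open>p\<^sup>2\<close>, and
since the complement has order \<open>3\<close> and fixes only the identity, this order is
\<open>1\<close> modulo \<open>3\<close>, which excludes \<open>p\<close>. If the character is
nontrivial on the axis, the core cannot contain the whole axis, so it meets it trivially.\<close>
lemma core_axis_trivial:
  assumes v: "v \<in> coords" and i: "i < t" and vi: "v i \<noteq> (0, 0)"
  shows "core (dual v) \<inter> axis i = {\<one>}"
proof -
  let ?H = "core (dual v) \<inter> axis i"
  have sg: "subgroup ?H G" by (rule subgroups_Inter_pair[OF subgroup_core[OF lin_char_dual] subgroup_axis[OF i]])
  have HA: "?H \<subseteq> A" by (auto simp: core_def)
  have finH: "finite ?H" using HA finite_A finite_subset by blast
  interpret V: group "G\<lparr>carrier := axis i\<rparr>"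
    by (rule subgroup_imp_group[OF subgroup_axis[OF i]])
  have "subgroup ?H (G\<lparr>carrier := axis i\<rparr>)"
    by (rule subgroup_incl[OF sg subgroup_axis[OF i]]) simp
  from V.lagrange[OF this] have "card ?H dvd card (axis i)"
    by (simp add: Coset.order_def) (metis dvd_triv_right)
  then have "card ?H dvd (pr i)^2" by (simp add: card_axis[OF i])
  then obtain k where k: "k \<le> 2" "card ?H = pr i ^ k"
    using divides_primepow_nat[OF pr(1)[OF i]] by blast
  have "?H \<noteq> axis i"
  proof
    assume H: "?H = axis i"
    have "v i = origin i"
    proof (rule dual_coordinate[OF v origin_coords i])
      fix a assume "a \<in> axis i"
      then have a: "a \<in> core (dual v)" "a \<in> A" using H by (auto simp: axis_def)
      then have "dual v (twist 0 a) = 1" unfolding core_def using q_pos by blast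
      then show "dual v a = dual origin a" using a(2) dual_origin by simp
    qed
    then show False using vi i by (simp add: origin_def)
  qed
  moreover have "finite (axis i)" using finite_A by (rule finite_subset[rotated]) (auto simp: axis_def)
  ultimately have "card ?H \<noteq> card (axis i)" using card_subset_eq[of "axis i" ?H] by blast
  then have "k \<noteq> 2" using k(2) card_axis[OF i] by auto
  then have k01: "k = 0 \<or> k = 1" using k(1) by linarith
  have "3 dvd card (?H - {\<one>})"
  proof (rule three_dvd_card_of_fixed_point_free_3_cycle[where f = "twist 1"])
    show "finite (?H - {\<one>})" using finH by simp
    fix s assume s: "s \<in> ?H - {\<one>}"
    then have sA: "s \<in> A" and s1: "s \<noteq> \<one>" using HA by auto
    show nf: "twist 1 s \<noteq> s" using twist_fixed[OF sA, of 1] s1 by auto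
    show c3: "twist 1 (twist 1 (twist 1 s)) = s" using sA twist_q[of s] by (simp add: twist_twist numeral_3_eq_3)
    have "twist 1 s \<noteq> \<one>"
    proof
      assume "twist 1 s = \<one>"
      then have "twist 1 (twist 1 (twist 1 s)) = \<one>" by simp
      then show False using c3 s1 by simp
    qed
    then show "twist 1 s \<in> ?H - {\<one>}" using s core_twist twist_axis[OF _ i] by blast
  qed
  moreover have "card (?H - {\<one>}) = card ?H - 1"
    using subgroup.one_closed[OF sg] finH by (simp add: card_Diff_singleton)
  ultimately have d: "3 dvd pr i ^ k - 1" using k(2) by simp
  have "k = 0"
  proof (rule ccontr)
    assume "k \<noteq> 0"
    then have "3 dvd pr i - 1" using d k01 by simp
    then show False using pr(2)[OF i] pr_pos[OF i] by presburger
  qed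
  then have "card ?H = 1" using k(2) by simp
  then show ?thesis using subgroup.one_closed[OF sg] by (metis card_1_singletonE singletonD)
qed

text \<open>The power of an element with exponent the product of the other primes stays in the
core and lies on the \<open>i\<close>-th axis, hence is trivial; that exponent is invertible
modulo \<open>pr i\<close>.\<close>
lemma core_coordinate_zero:
  assumes v: "v \<in> coords" and i: "i < t" and vi: "v i \<noteq> (0, 0)" and k: "k \<in> core (dual v)"
  shows "\<phi> k i = (0, 0)"
proof -
  let ?n = "\<Prod>j\<in>{..<t} - {i}. pr j"
  have kA: "k \<in> A" using k by (simp add: core_def)
  have "k [^] ?n \<in> core (dual v)"
  proof -
    have "k [^] n \<in> core (dual v)" for n :: nat
      by (induction n) (use subgroup_core[OF lin_char_dual] k in
        \<open>simp_all add: subgroup.one_closed subgroup.m_closed\<close>)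
    then show ?thesis .
  qed
  moreover have "k [^] ?n \<in> axis i"
    unfolding axis_def using pow_A[OF kA] phi_pow_eq_0_iff[OF kA] by (auto intro: dvd_prodI)
  ultimately have "k [^] ?n = \<one>" using core_axis_trivial[OF v i vi] by blast
  then have "\<phi> (k [^] ?n) i = (0, 0)" using phi_one[OF i] by simp
  moreover have "\<not> pr i dvd ?n"
  proof
    assume "pr i dvd ?n"
    then obtain j where j: "j \<in> {..<t} - {i}" "pr i dvd pr j"
      using prime_dvd_prod_iff[of "{..<t} - {i}" "pr i" pr] pr(1)[OF i] by auto
    then have "pr i = pr j" using primes_dvd_imp_eq pr(1) i by blast
    then show False using inj_onD[OF pr(3)] i j by blast
  qed
  ultimately show ?thesis using phi_pow_eq_0_iff[OF kA i] by blast
qed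

text \<open>An element of the core is determined by its coordinates at the places where
\<open>v\<close> vanishes.\<close>
lemma card_core_dual:
  assumes v: "v \<in> coords"
  shows "card (core (dual v)) * (\<Prod>i<t. if v i = (0,0) then 1 else (pr i)^2) \<le> card A"
proof -
  let ?C = "\<lambda>i. if v i = (0,0) then box i else {(0,0)}"
  have sub: "\<phi> ` core (dual v) \<subseteq> (\<Pi>\<^sub>E i\<in>{..<t}. ?C i)"
  proof
    fix y assume "y \<in> \<phi> ` core (dual v)"
    then obtain k where k: "k \<in> core (dual v)" "y = \<phi> k" by blast
    then have kA: "k \<in> A" by (simp add: core_def)
    show "y \<in> (\<Pi>\<^sub>E i\<in>{..<t}. ?C i)"
      using phi_coords[OF kA] core_coordinate_zero[OF v _ _ k(1)] unfolding k(2) coords_def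
      by (auto simp: PiE_iff)
  qed
  have "inj_on \<phi> (core (dual v))"
    using phi_bij unfolding bij_betw_def by (rule inj_on_subset[OF conjunct1]) (auto simp: core_def)
  then have "card (core (dual v)) = card (\<phi> ` core (dual v))" by (simp add: card_image)
  also have "\<dots> \<le> card (\<Pi>\<^sub>E i\<in>{..<t}. ?C i)"
    by (rule card_mono[OF _ sub]) (auto intro!: finite_PiE)
  also have "\<dots> = (\<Prod>i<t. if v i = (0,0) then (pr i)^2 else 1)"
    by (simp add: card_PiE if_distrib[of card] card_cartesian_product power2_eq_square cong: if_cong)
  finally have "card (core (dual v)) * (\<Prod>i<t. if v i = (0,0) then 1 else (pr i)^2) \<le>
      (\<Prod>i<t. if v i = (0,0) then (pr i)^2 else 1) * (\<Prod>i<t. if v i = (0,0) then 1 else (pr i)^2)"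
    by (rule mult_right_mono) simp
  also have "\<dots> = card A"
    unfolding card_A prod.distrib[symmetric] by (rule prod.cong) auto
  finally show ?thesis .
qed

text \<open>A character that is nontrivial exactly on the axes in \<open>I\<close> contributes at
least the product of \<open>p\<^sup>2\<close> over the primes of \<open>I\<close>. Summing over
all characters, the trivial one included, factors into the product of \<open>1 + (p\<^sup>2 - 1)
p\<^sup>2\<close>, and the trivial one accounts for the subtracted \<open>1\<close>.\<close>
theorem sum_codegrees_rank_two_ge:
  "(\<Prod>i<t. real (pr i)^4 - real (pr i)^2 + 1) - 1 \<le> 3 * sum_codegrees G"
proof -
  let ?f = "\<lambda>i b. if b = (0, 0) then 1 else real (pr i)^2"
  let ?L = "dual ` (coords - {origin})"
  have finD: "finite coords" unfolding coords_def by (rule finite_PiE) auto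
  have "(\<Sum>b\<in>box i. ?f i b) = real (pr i)^4 - real (pr i)^2 + 1" if i: "i < t" for i
  proof -
    have z: "(0,0) \<in> box i" using pr_pos[OF i] by simp
    have "(\<Sum>b\<in>box i. ?f i b) = 1 + (\<Sum>b\<in>box i - {(0,0)}. ?f i b)"
      using z by (subst sum.remove[of _ "(0,0)"]) auto
    also have "(\<Sum>b\<in>box i - {(0,0)}. ?f i b) = (\<Sum>b\<in>box i - {(0,0)}. real (pr i)^2)"
      by (rule sum.cong) auto
    also have "\<dots> = real ((pr i)^2 - 1) * real (pr i)^2"
      using z by (simp add: card_Diff_singleton card_cartesian_product power2_eq_square)
    also have "real ((pr i)^2 - 1) = real (pr i)^2 - 1"
      using pr_pos[OF i] by (simp add: of_nat_diff)
    finally show ?thesis by (simp add: algebra_simps power2_eq_square power4_eq_xxxx)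
  qed
  then have "(\<Prod>i<t. real (pr i)^4 - real (pr i)^2 + 1) = (\<Prod>i<t. \<Sum>b\<in>box i. ?f i b)"
    by simp
  also have "\<dots> = (\<Sum>v\<in>coords. \<Prod>i<t. ?f i (v i))"
    unfolding coords_def by (rule prod_sum_PiE) auto
  also have "\<dots> = (\<Prod>i<t. ?f i (origin i)) + (\<Sum>v\<in>coords - {origin}. \<Prod>i<t. ?f i (v i))"
    by (rule sum.remove[OF finD origin_coords])
  also have "(\<Prod>i<t. ?f i (origin i)) = 1" by (simp add: origin_def)
  finally have "(\<Prod>i<t. real (pr i)^4 - real (pr i)^2 + 1) - 1 = (\<Sum>v\<in>coords - {origin}. \<Prod>i<t. ?f i (v i))"
    by simp
  also have "\<dots> \<le> (\<Sum>v\<in>coords - {origin}. real (card A) / real (card (core (dual v))))"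
  proof (rule sum_mono)
    fix v assume "v \<in> coords - {origin}"
    then have v: "v \<in> coords" by simp
    have "card (core (dual v)) > 0"
      using subgroup.finite_imp_card_positive[OF subgroup_core[OF lin_char_dual] fin] .
    moreover have "real (card (core (dual v)) * (\<Prod>i<t. if v i = (0,0) then 1 else (pr i)^2)) \<le> real (card A)"
      using card_core_dual[OF v] by (simp only: of_nat_le_iff)
    moreover have "real (\<Prod>i<t. if v i = (0,0) then 1 else (pr i)^2) = (\<Prod>i<t. ?f i (v i))"
      unfolding of_nat_prod by (rule prod.cong) auto
    ultimately show "(\<Prod>i<t. ?f i (v i)) \<le> real (card A) / real (card (core (dual v)))"
      by (simp add: pos_le_divide_eq mult.commute)
  qed
  also have "\<dots> = (\<Sum>l\<in>?L. real (card A) / real (card (core l)))"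
    using inj_on_subset[OF inj_on_dual, of "coords - {origin}"] by (simp add: sum.reindex)
  also have "\<dots> \<le> real 3 * sum_codegrees G"
  proof (rule sum_codegrees_ge)
    fix l assume "l \<in> ?L"
    then obtain v where v: "v \<in> coords" "v \<noteq> origin" "l = dual v" by blast
    show "lin_char l" unfolding v(3) by (rule lin_char_dual)
    show "\<exists>a\<in>A. l a \<noteq> 1"
    proof (rule ccontr)
      assume neg: "\<not> ?thesis"
      have "v i = origin i" if "i < t" for i
        by (rule dual_coordinate[OF v(1) origin_coords that])
          (use neg v(3) dual_origin in \<open>auto simp: axis_def\<close>)
      then show False using coords_eqI[OF v(1) origin_coords] v(2) by blast
    qed
  qed (use finD in simp)
  finally show ?thesis by simp
qed

end

section \<open>The quotient of the sums of codegrees\<close>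

lemma cyclic_3_generator:
  assumes G: "group G" and P: "subgroup P G" and iso: "G\<lparr>carrier := P\<rparr> \<cong> integer_mod_group 3"
  obtains x where "x \<in> P" "x [^]\<^bsub>G\<^esub> (3::nat) = \<one>\<^bsub>G\<^esub>" "x \<noteq> \<one>\<^bsub>G\<^esub>" "x [^]\<^bsub>G\<^esub> (2::nat) \<noteq> \<one>\<^bsub>G\<^esub>"
    "P = {\<one>\<^bsub>G\<^esub>, x, x [^]\<^bsub>G\<^esub> (2::nat)}"
proof -
  interpret group G by (rule G)
  interpret P: group "G\<lparr>carrier := P\<rparr>" by (rule subgroup_imp_group[OF P])
  have "\<exists>h. bij_betw h P (carrier (integer_mod_group 3))"
    using iso unfolding is_iso_def iso_def by auto
  then have c: "card P = 3" by (auto dest!: bij_betw_same_card simp: carrier_integer_mod_group)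
  then have fin: "finite P" by (metis card.infinite zero_neq_numeral)
  have one: "\<one>\<^bsub>G\<^esub> \<in> P" by (rule subgroup.one_closed[OF P])
  have "P \<noteq> {\<one>\<^bsub>G\<^esub>}" using c by auto
  then obtain x where x: "x \<in> P" "x \<noteq> \<one>\<^bsub>G\<^esub>" using one by blast
  have xG: "x \<in> carrier G" using subgroup.subset[OF P] x(1) by blast
  have "x [^]\<^bsub>G\<lparr>carrier := P\<rparr>\<^esub> Coset.order (G\<lparr>carrier := P\<rparr>) = \<one>\<^bsub>G\<lparr>carrier := P\<rparr>\<^esub>"
    by (rule P.pow_order_eq_1) (use x in simp)
  then have x3: "x [^]\<^bsub>G\<^esub> (3::nat) = \<one>\<^bsub>G\<^esub>"
    using c by (simp add: Coset.order_def nat_pow_consistent[symmetric])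
  have x3': "x [^]\<^bsub>G\<^esub> (2::nat) \<otimes>\<^bsub>G\<^esub> x = \<one>\<^bsub>G\<^esub>"
    using x3 by (simp add: numeral_3_eq_3 numeral_2_eq_2)
  have x2: "x [^]\<^bsub>G\<^esub> (2::nat) = x \<otimes>\<^bsub>G\<^esub> x" using xG by (simp add: numeral_2_eq_2)
  have n2: "x [^]\<^bsub>G\<^esub> (2::nat) \<noteq> \<one>\<^bsub>G\<^esub>" using x3' x(2) xG by auto
  have n1: "x [^]\<^bsub>G\<^esub> (2::nat) \<noteq> x" using l_cancel_one[of x x] x2 x(2) xG by simp
  have "{\<one>\<^bsub>G\<^esub>, x, x [^]\<^bsub>G\<^esub> (2::nat)} \<subseteq> P"
    using one x(1) subgroup.m_closed[OF P] x2 by auto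
  moreover have "card {\<one>\<^bsub>G\<^esub>, x, x [^]\<^bsub>G\<^esub> (2::nat)} = 3"
    using x(2) n1 n2 by (auto simp: card_insert_if)
  ultimately have "P = {\<one>\<^bsub>G\<^esub>, x, x [^]\<^bsub>G\<^esub> (2::nat)}"
    using card_subset_eq[OF fin] c by metis
  then show ?thesis using that x x3 n2 by blast
qed

text \<open>An element of \<open>A\<close> that commutes with one nontrivial element of
\<open>P\<close> commutes with all of \<open>P\<close>, because \<open>P\<close> has prime order.
So a trivial centralizer means that the action is free of fixed points.\<close>
lemma semidirect_product_frobenius_rank_two:
  fixes G :: "('a, 'b) monoid_scheme"
  assumes G: "group G" and fin: "finite (carrier G)"
    and sd: "internal_semidirect_product G A P"
    and P: "G\<lparr>carrier := P\<rparr> \<cong> integer_mod_group 3"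
    and A: "G\<lparr>carrier := A\<rparr> \<cong> product_group {..<t} (\<lambda>i. integer_mod_group (pr i) \<times>\<times> integer_mod_group (pr i))"
    and cent: "centralizer_in G A P = {\<one>\<^bsub>G\<^esub>}"
    and pr: "\<And>i. i < t \<Longrightarrow> prime (pr i)" "\<And>i. i < t \<Longrightarrow> pr i mod 3 = 2" "inj_on pr {..<t}"
  obtains x \<phi> where "frobenius_rank_two G A x t pr \<phi>"
proof -
  interpret group G by (rule G)
  let ?Q = "product_group {..<t} (\<lambda>i. integer_mod_group (pr i) \<times>\<times> integer_mod_group (pr i))"
  have nA: "A \<lhd> G" and sP: "subgroup P G" and AP: "A <#>\<^bsub>G\<^esub> P = carrier G" and meet: "A \<inter> P = {\<one>\<^bsub>G\<^esub>}"
    using sd by (auto simp: internal_semidirect_product_def)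
  have sA: "subgroup A G" using nA by (simp add: normal_def)
  have AG: "a \<in> carrier G" if "a \<in> A" for a using subgroup.subset[OF sA] that by blast
  obtain x where x: "x \<in> P" "x [^]\<^bsub>G\<^esub> (3::nat) = \<one>\<^bsub>G\<^esub>" "x \<noteq> \<one>\<^bsub>G\<^esub>" "x [^]\<^bsub>G\<^esub> (2::nat) \<noteq> \<one>\<^bsub>G\<^esub>"
    and Peq: "P = {\<one>\<^bsub>G\<^esub>, x, x [^]\<^bsub>G\<^esub> (2::nat)}"
    using cyclic_3_generator[OF G sP P] by blast
  have xG: "x \<in> carrier G" using subgroup.subset[OF sP] x(1) by blast
  have x1: "x [^]\<^bsub>G\<^esub> (1::nat) = x" using xG by simp
  obtain \<phi> where phi: "\<phi> \<in> hom (G\<lparr>carrier := A\<rparr>) ?Q" "bij_betw \<phi> A (carrier ?Q)"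
    using A unfolding is_iso_def iso_def by auto
  have car: "carrier ?Q = (\<Pi>\<^sub>E i\<in>{..<t}. {0..<int (pr i)} \<times> {0..<int (pr i)})"
    unfolding carrier_product_group
    by (rule PiE_cong) (use prime_gt_0_nat[OF pr(1)] in \<open>auto simp: carrier_integer_mod_group DirProd_def\<close>)
  have mult: "\<phi> (a \<otimes>\<^bsub>G\<^esub> b) i = ((fst (\<phi> a i) + fst (\<phi> b i)) mod int (pr i), (snd (\<phi> a i) + snd (\<phi> b i)) mod int (pr i))"
    if "a \<in> A" "b \<in> A" "i < t" for a b i
    using hom_mult[OF phi(1), of a b] that by (simp add: DirProd_def case_prod_beta)
  have A_comm: "a \<otimes>\<^bsub>G\<^esub> b = b \<otimes>\<^bsub>G\<^esub> a" if ab: "a \<in> A" "b \<in> A" for a b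
  proof -
    have "\<phi> (a \<otimes>\<^bsub>G\<^esub> b) = \<phi> (b \<otimes>\<^bsub>G\<^esub> a)"
      using hom_mult[OF phi(1), of a b] hom_mult[OF phi(1), of b a] ab
      by (simp add: DirProd_def case_prod_beta add.commute)
    then show ?thesis
      using bij_betw_imp_inj_on[OF phi(2)] subgroup.m_closed[OF sA] ab by (simp add: inj_on_eq_iff)
  qed
  have "frobenius_cyclic_complement G A x 3"
  proof (rule frobenius_cyclic_complement.intro[OF G frobenius_cyclic_complement_axioms.intro])
    show "finite (carrier G)" by (rule fin)
    show "A \<lhd> G" by (rule nA)
    show "a \<otimes>\<^bsub>G\<^esub> b = b \<otimes>\<^bsub>G\<^esub> a" if "a \<in> A" "b \<in> A" for a b by (rule A_comm[OF that])
    show "x \<in> carrier G" by (rule xG)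
    show "(3::nat) > 0" by simp
    show "x [^]\<^bsub>G\<^esub> (3::nat) = \<one>\<^bsub>G\<^esub>" by (rule x(2))
    show "\<exists>a\<in>A. \<exists>j<3. g = a \<otimes>\<^bsub>G\<^esub> x [^]\<^bsub>G\<^esub> (j::nat)" if g: "g \<in> carrier G" for g
    proof -
      obtain a y where ay: "a \<in> A" "y \<in> P" "g = a \<otimes>\<^bsub>G\<^esub> y"
        using g unfolding AP[symmetric] set_mult_def by blast
      have "\<exists>j<3. y = x [^]\<^bsub>G\<^esub> (j::nat)"
      proof -
        consider "y = \<one>\<^bsub>G\<^esub>" | "y = x" | "y = x [^]\<^bsub>G\<^esub> (2::nat)" using ay(2) Peq by blast
        then show ?thesis
        proof cases
          case 1 then show ?thesis by (intro exI[of _ 0]) simp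
        next
          case 2 then show ?thesis using x1 by (intro exI[of _ 1]) simp
        next
          case 3 then show ?thesis by (intro exI[of _ 2]) simp
        qed
      qed
      then show ?thesis using ay by blast
    qed
    have j12: "j = 1 \<or> j = 2" if "0 < j" "j < 3" for j :: nat using that by linarith
    show "x [^]\<^bsub>G\<^esub> j \<notin> A" if j: "0 < j" "j < 3" for j :: nat
    proof
      assume "x [^]\<^bsub>G\<^esub> j \<in> A"
      moreover have "x [^]\<^bsub>G\<^esub> j \<in> P" using j12[OF j] Peq x1 by auto
      ultimately have "x [^]\<^bsub>G\<^esub> j = \<one>\<^bsub>G\<^esub>" using meet by blast
      then show False using j12[OF j] x(3,4) x1 by auto
    qed
    show "a = \<one>\<^bsub>G\<^esub>" if a: "a \<in> A" and j: "0 < j" "j < 3"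
      and com: "a \<otimes>\<^bsub>G\<^esub> x [^]\<^bsub>G\<^esub> j = x [^]\<^bsub>G\<^esub> j \<otimes>\<^bsub>G\<^esub> a" for a and j :: nat
    proof -
      note aG = AG[OF a]
      have sq: "a \<otimes>\<^bsub>G\<^esub> (y \<otimes>\<^bsub>G\<^esub> y) = (y \<otimes>\<^bsub>G\<^esub> y) \<otimes>\<^bsub>G\<^esub> a"
        if y: "y \<in> carrier G" "a \<otimes>\<^bsub>G\<^esub> y = y \<otimes>\<^bsub>G\<^esub> a" for y
      proof -
        have "a \<otimes>\<^bsub>G\<^esub> (y \<otimes>\<^bsub>G\<^esub> y) = (a \<otimes>\<^bsub>G\<^esub> y) \<otimes>\<^bsub>G\<^esub> y" using aG y(1) by (simp only: m_assoc)
        also have "\<dots> = y \<otimes>\<^bsub>G\<^esub> (a \<otimes>\<^bsub>G\<^esub> y)" unfolding y(2) using aG y(1) by (simp only: m_assoc) (simp only: y(2))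
        also have "\<dots> = (y \<otimes>\<^bsub>G\<^esub> y) \<otimes>\<^bsub>G\<^esub> a" unfolding y(2) using aG y(1) by (simp only: m_assoc)
        finally show ?thesis .
      qed
      have x22: "x [^]\<^bsub>G\<^esub> (2::nat) \<otimes>\<^bsub>G\<^esub> x [^]\<^bsub>G\<^esub> (2::nat) = x"
      proof -
        have "x [^]\<^bsub>G\<^esub> (2::nat) \<otimes>\<^bsub>G\<^esub> x [^]\<^bsub>G\<^esub> (2::nat) = x [^]\<^bsub>G\<^esub> (3::nat) \<otimes>\<^bsub>G\<^esub> x [^]\<^bsub>G\<^esub> (1::nat)"
          unfolding nat_pow_mult[OF xG] by (rule arg_cong) simp
        then show ?thesis using x(2) xG by simp
      qed
      have x11: "x \<otimes>\<^bsub>G\<^esub> x = x [^]\<^bsub>G\<^esub> (2::nat)" using xG by (simp add: numeral_2_eq_2)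
      have cx: "a \<otimes>\<^bsub>G\<^esub> x = x \<otimes>\<^bsub>G\<^esub> a"
        using j12[OF j]
      proof
        assume "j = 1" then show ?thesis using com x1 by simp
      next
        assume "j = 2" then show ?thesis using sq[of "x [^]\<^bsub>G\<^esub> (2::nat)"] com x22 xG by simp
      qed
      have cx2: "a \<otimes>\<^bsub>G\<^esub> x [^]\<^bsub>G\<^esub> (2::nat) = x [^]\<^bsub>G\<^esub> (2::nat) \<otimes>\<^bsub>G\<^esub> a"
        using sq[OF xG cx] unfolding x11 .
      have "a \<in> centralizer_in G A P"
        unfolding centralizer_in_def Peq using a cx cx2 aG by auto
      then show ?thesis using cent by blast
    qed
  qed
  then have "frobenius_rank_two G A x t pr \<phi>"
  proof (rule frobenius_rank_two.intro[OF _ frobenius_rank_two_axioms.intro])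
    show "bij_betw \<phi> A (\<Pi>\<^sub>E i\<in>{..<t}. {0..<int (pr i)} \<times> {0..<int (pr i)})"
      using phi(2) unfolding car .
  qed (simp_all add: pr mult)
  then show ?thesis using that by blast
qed

theorem theorem4p1:
  fixes G :: "nat \<Rightarrow> ('a, 'b) monoid_scheme"
    and A P :: "nat \<Rightarrow> 'a set"
  assumes "\<And>t. t \<ge> 1 \<Longrightarrow> group (G t)"
    and "\<And>t. t \<ge> 1 \<Longrightarrow> finite (carrier (G t))"
    and "\<And>t. t \<ge> 1 \<Longrightarrow> internal_semidirect_product (G t) (A t) (P t)"
    and "\<And>t. t \<ge> 1 \<Longrightarrow> (G t)\<lparr>carrier := P t\<rparr> \<cong> integer_mod_group 3"
    and "\<And>t. t \<ge> 1 \<Longrightarrow> (G t)\<lparr>carrier := A t\<rparr> \<cong>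
           product_group {..<t} (\<lambda>i. integer_mod_group (prime_2_mod_3 i) \<times>\<times>
                                     integer_mod_group (prime_2_mod_3 i))"
    and "\<And>t. t \<ge> 1 \<Longrightarrow> centralizer_in (G t) (A t) (P t) = {\<one>\<^bsub>G t\<^esub>}"
  shows "filterlim (\<lambda>t. sum_codegrees (G t) /
                         sum_codegrees (integer_mod_group (Coset.order (G t))))
           at_top sequentially"
proof -
  let ?p = "prime_2_mod_3"
  let ?X = "\<lambda>i. real (?p i)^4 - real (?p i)^2 + 1"
  let ?Y = "\<lambda>i. real (?p i)^4 - real (?p i)^3 + real (?p i)^2 - real (?p i) + 1"
  have p2: "real (?p i) \<ge> 2" for i
    using prime_ge_2_nat[OF prime_2_mod_3_props(1)[of i]] by simp
  have X2: "?X i \<ge> 2" for i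
  proof -
    have "real (?p i)^2 \<ge> 2^2" using p2[of i] by (intro power_mono) auto
    then have "real (?p i)^2 * (real (?p i)^2 - 1) \<ge> 4 * 3" by (intro mult_mono) auto
    then show ?thesis by (simp add: algebra_simps power2_eq_square power4_eq_xxxx)
  qed
  have Y0: "?Y i > 0" for i
  proof -
    have "real (?p i)^3 * (real (?p i) - 1) \<ge> 0" "real (?p i) * (real (?p i) - 1) \<ge> 0" using p2[of i] by auto
    then show ?thesis by (simp add: algebra_simps power2_eq_square power3_eq_cube power4_eq_xxxx)
  qed
  \<comment> \<open>The constant \<open>42 = 6 * 7\<close>: the lower bound is at least
  \<open>1/6\<close> of the product of the \<open>?X i\<close>, because that product is at least
  \<open>2\<close> and hence its half absorbs the subtracted \<open>1\<close>.\<close>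
  have bound: "(1 / 42) * (\<Prod>i<t. ?X i / ?Y i) \<le>
     sum_codegrees (G t) / sum_codegrees (integer_mod_group (Coset.order (G t)))" if t: "t \<ge> 1" for t
  proof -
    let ?n = "Coset.order (G t)"
    let ?S = "sum_codegrees (G t)" and ?C = "sum_codegrees (integer_mod_group ?n)"
    have inj: "inj_on ?p {..<t}" using prime_2_mod_3_props(3) by (rule inj_on_subset) simp
    obtain x \<phi> where F: "frobenius_rank_two (G t) (A t) x t ?p \<phi>"
      using semidirect_product_frobenius_rank_two[OF assms(1-6)[OF t] prime_2_mod_3_props(1,2) inj] by blast
    interpret frobenius_rank_two "G t" "A t" x t ?p \<phi> by (rule F)
    have n: "?n = 3 * (\<Prod>i<t. (?p i)^2)" using order_G card_A by simp
    have "(\<Prod>i<t. (?p i)^2) > 0" using pr_pos by (intro prod_pos) auto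
    then have n2: "?n \<ge> 2" unfolding n by linarith
    have lower: "(\<Prod>i<t. ?X i) - 1 \<le> 3 * ?S" by (rule sum_codegrees_rank_two_ge)
    have "?p i \<noteq> 3" for i using prime_2_mod_3_props(2)[of i] by auto
    then have "(\<Sum>d | d dvd 3 * (\<Prod>i<t. (?p i)^2). real (d * totient d)) \<le> 7 * (\<Prod>i<t. ?Y i)"
      by (intro divisor_totient_sum_le[OF inj prime_2_mod_3_props(1)])
    then have upper: "?C \<le> 7 * (\<Prod>i<t. ?Y i)"
      using sum_codegrees_cyclic_le[OF n2] unfolding n by (rule order_trans[rotated])
    have C0: "?C > 0"
      using n2 by (intro sum_codegrees_pos) (auto simp: carrier_integer_mod_group)
    have "2 \<le> (\<Prod>i<t. ?X i)"
    proof -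
      have "1 \<le> (\<Prod>i\<in>{..<t} - {0}. ?X i)" using X2 by (intro prod_ge_1) (smt (verit))
      then have "2 * 1 \<le> ?X 0 * (\<Prod>i\<in>{..<t} - {0}. ?X i)" using X2[of 0] by (intro mult_mono) auto
      also have "\<dots> = (\<Prod>i<t. ?X i)" using t by (subst (2) prod.remove[of _ 0]) auto
      finally show ?thesis by simp
    qed
    then have "(\<Prod>i<t. ?X i) / 6 \<le> ?S" using lower by linarith
    then have "(\<Prod>i<t. ?X i) / 6 * ?C \<le> ?S * (7 * (\<Prod>i<t. ?Y i))"
      using upper C0 \<open>2 \<le> (\<Prod>i<t. ?X i)\<close> by (intro mult_mono) auto
    moreover have "(\<Prod>i<t. ?Y i) > 0" using Y0 by (intro prod_pos) auto
    ultimately show ?thesis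
      using C0 unfolding prod_dividef by (simp add: field_simps)
  qed
  have "filterlim (\<lambda>t. (1 / 42) * (\<Prod>i<t. ?X i / ?Y i)) at_top sequentially"
    by (rule filterlim_tendsto_pos_mult_at_top[OF tendsto_const _ prod_codegree_ratio_at_top]) simp
  then show ?thesis
    by (rule filterlim_at_top_mono) (use bound in \<open>auto simp: eventually_sequentially\<close>)
qed

end
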